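(* Let $X=\bigsqcup_{\lambda\in\Lambda}G_\lambda$ be a multiple conjugation biquandle. Let $D$ be a diagram of an $S^1$-oriented handlebody-link $H$ (i.e. a diagram of a Y-oriented spatial trivalent graph representing $H$). Let $D'$ be a diagram obtained by applying one of the Y-oriented R1--R6 moves to $D$ once. Then for every $X$-coloring $C$ of $D$ there is a unique $X$-coloring $C'$ of $D'$ which coincides with $C$ except at the place where the move is applied (i.e. $C$ and $C'$ assign the same color to every part of the diagram lying outside the disk in which the move takes place).
   Context: A biquandle is a non-empty set $X$ with binary operations $\underline{*},\overline{*}$ such that: $x\underline{*}x=x\overline{*}x$; for every $a$ the maps $x\mapsto x\underline{*}a$, $x\mapsto x\overline{*}a$ are bijections of $X$ and $(x,y)\mapsto(y\overline{*}x,x\underline{*}y)$ is a bijection of $X\times X$; and for all $x,y,z$: $(x\underline{*}y)\underline{*}(z\underline{*}y)=(x\underline{*}z)\underline{*}(y\overline{*}z)$, $(x\underline{*}y)\overline{*}(z\underline{*}y)=(x\overline{*}z)\underline{*}(y\overline{*}z)$, $(x\overline{*}y)\overline{*}(z\overline{*}y)=(x\overline{*}z)\overline{*}(y\underline{*}z)$. A multiple conjugation biquandle is a biquandle $X$ which is a disjoint union of groups $G_\lambda$ ($\lambda\in\Lambda$), with $G_a$ the group containing $a$, such that for all $a,x\in X$ the maps $\underline{*}x:G_a\to G_{a\underline{*}x}$ and $\overline{*}x:G_a\to G_{a\overline{*}x}$ are group homomorphisms, and for all $\lambda$, $a,b\in G_\lambda$, $x\in X$: $x\underline{*}(ab)=(x\underline{*}a)\underline{*}(b\overline{*}a)$,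 $x\overline{*}(ab)=(x\overline{*}a)\overline{*}(b\overline{*}a)$, $(a^{-1}b)\overline{*}a=(ba^{-1})\underline{*}a$. For $a,b\in G_\lambda$ put $a\triangle b:=(b^{-1}a)\overline{*}b$. A handlebody-link is a disjoint union of handlebodies (each of genus at least $1$) embedded in $S^3$; an $S^1$-orientation is a choice of orientation of the core circle of each genus-$1$ component. A Y-orientation of a trivalent graph (circle components without vertices allowed) is a direction of all edges such that every vertex is both the initial vertex of some directed edge and the terminal vertex of some directed edge (so each vertex has two incoming and one outgoing, or one incoming and two outgoing, edge-ends). A Y-oriented trivalent graph $K$ embedded in $S^3$ represents $H$ if $H$ is a regular neighborhood of $K$ and the $S^1$-orientation of $H$ agrees with the Y-orientation. Diagrams are the usual planar (or spherical) diagrams with over/under information at transverse double points. Moves (each replaces the diagram inside a disk; Y-oriented means that both diagrams are Y-oriented and their orientations agree outside the disk): R1: create/remove a kink with one crossing (either crossing type) on a strand. R2: create/remove two crossings between two strands, one strand being over at both. R3: the usual move of three strands at a triangle of crossings (top, middle and bottom strand). R4: create/remove a single crossing (either type) between two of the three edges emanating from a vertex, next to that vertex. R5: for a vertex with three edges and a strand crossing all three edges near the vertex, being over at all three crossings or under at all three, move the strand across the vertex, so that it crosses none of the three edges (and the inverse). R6 (IH-move): replace an edge with two distinct endpoints, shaped like the bar of the letter I joining a vertex with two upper edge-ends to a vertex with two lower edge-ends, by the H-shaped configuration in which a new edge joins a vertex on the left (attached to upper left and lower left ends) with a vertex on the right (attached to upper right and lower right ends); no crossings occur in the disk. A semi-arc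 of $D$ is a piece of a curve of $D$ each of whose endpoints is a crossing or a vertex (so over-strands are also cut at crossings; a circle component without crossings counts as one semi-arc); $\mathcal{SA}(D)$ denotes the set of semi-arcs. An $X$-coloring of $D$ is a map $C:\mathcal{SA}(D)\to X$ satisfying the following, where pictures are considered up to rotation of the plane. Crossings, drawn with both strands directed downward: - if the over-strand runs from upper right to lower left and the under-strand from upper left to lower right, then for some $a,b\in X$ the colors are: upper left $a$, lower left $b$, upper right $b\overline{*}a$, lower right $a\underline{*}b$; - if the over-strand runs from upper left to lower right and the under-strand from upper right to lower left, then for some $a,b\in X$ the colors are: upper left $a$, lower left $b$, upper right $b\underline{*}a$, lower right $a\overline{*}b$. Vertices: - two incoming edges from upper left and upper right, one outgoing edge downward: for some $\lambda$ and $a,b\in G_\lambda$ the colors are: upper left $b$, upper right $a\triangle b$, bottom $a$; - one incoming edge from the top, two outgoing edges to lower left and lower right: for some $\lambda$ and $a,b\in G_\lambda$ the colors are: top $a$, lower left $b$, lower right $a\triangle b$. *)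

theory Defs
  imports "HOL-Algebra.Group" "HOL-Library.Multiset" "HOL-Library.FuncSet"
    "HOL-Library.Disjoint_Sets"
begin

section \<open>Multiple conjugation biquandles\<close>

text \<open>The operation with the bar below is written \<open>x \<star>\<^sub>u y\<close>, the one with the bar above \<open>x \<star>\<^sub>o y\<close>.\<close>

locale biquandle =
  fixes X :: "'x set"
    and us :: "'x \<Rightarrow> 'x \<Rightarrow> 'x"  (infixl "\<star>\<^sub>u" 70)
    and os :: "'x \<Rightarrow> 'x \<Rightarrow> 'x"  (infixl "\<star>\<^sub>o" 70)
  assumes nonempty: "X \<noteq> {}"
    and diagonal: "x \<in> X \<Longrightarrow> x \<star>\<^sub>u x = x \<star>\<^sub>o x"
    and bij_us: "a \<in> X \<Longrightarrow> bij_betw (\<lambda>x. x \<star>\<^sub>u a) X X"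
    and bij_os: "a \<in> X \<Longrightarrow> bij_betw (\<lambda>x. x \<star>\<^sub>o a) X X"
    and bij_pair: "bij_betw (\<lambda>(x, y). (y \<star>\<^sub>o x, x \<star>\<^sub>u y)) (X \<times> X) (X \<times> X)"
    and exchange_uu: "\<lbrakk>x \<in> X; y \<in> X; z \<in> X\<rbrakk> \<Longrightarrow>
          (x \<star>\<^sub>u y) \<star>\<^sub>u (z \<star>\<^sub>u y) = (x \<star>\<^sub>u z) \<star>\<^sub>u (y \<star>\<^sub>o z)"
    and exchange_uo: "\<lbrakk>x \<in> X; y \<in> X; z \<in> X\<rbrakk> \<Longrightarrow>
          (x \<star>\<^sub>u y) \<star>\<^sub>o (z \<star>\<^sub>u y) = (x \<star>\<^sub>o z) \<star>\<^sub>u (y \<star>\<^sub>o z)"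
    and exchange_oo: "\<lbrakk>x \<in> X; y \<in> X; z \<in> X\<rbrakk> \<Longrightarrow>
          (x \<star>\<^sub>o y) \<star>\<^sub>o (z \<star>\<^sub>o y) = (x \<star>\<^sub>o z) \<star>\<^sub>o (y \<star>\<^sub>u z)"

text \<open>The group containing \<open>a\<close>, for a family of groups with pairwise disjoint carriers.\<close>

definition group_at :: "'l set \<Rightarrow> ('l \<Rightarrow> ('x, 'm) monoid_scheme) \<Rightarrow> 'x \<Rightarrow> ('x, 'm) monoid_scheme"
  where "group_at L G a = G (THE l. l \<in> L \<and> a \<in> carrier (G l))"

locale multiple_conjugation_biquandle = biquandle X us os
  for X :: "'x set"
    and us :: "'x \<Rightarrow> 'x \<Rightarrow> 'x"  (infixl "\<star>\<^sub>u" 70)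
    and os :: "'x \<Rightarrow> 'x \<Rightarrow> 'x"  (infixl "\<star>\<^sub>o" 70) +
  fixes L :: "'l set"
    and G :: "'l \<Rightarrow> ('x, 'm) monoid_scheme"
  assumes groups: "l \<in> L \<Longrightarrow> group (G l)"
    and disjoint: "disjoint_family_on (\<lambda>l. carrier (G l)) L"
    and union: "X = (\<Union>l\<in>L. carrier (G l))"
    and us_hom: "\<lbrakk>a \<in> X; x \<in> X\<rbrakk> \<Longrightarrow>
          (\<lambda>g. g \<star>\<^sub>u x) \<in> hom (group_at L G a) (group_at L G (a \<star>\<^sub>u x))"
    and os_hom: "\<lbrakk>a \<in> X; x \<in> X\<rbrakk> \<Longrightarrow>
          (\<lambda>g. g \<star>\<^sub>o x) \<in> hom (group_at L G a) (group_at L G (a \<star>\<^sub>o x))"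
    and us_mult: "\<lbrakk>l \<in> L; a \<in> carrier (G l); b \<in> carrier (G l); x \<in> X\<rbrakk> \<Longrightarrow>
          x \<star>\<^sub>u (a \<otimes>\<^bsub>G l\<^esub> b) = (x \<star>\<^sub>u a) \<star>\<^sub>u (b \<star>\<^sub>o a)"
    and os_mult: "\<lbrakk>l \<in> L; a \<in> carrier (G l); b \<in> carrier (G l); x \<in> X\<rbrakk> \<Longrightarrow>
          x \<star>\<^sub>o (a \<otimes>\<^bsub>G l\<^esub> b) = (x \<star>\<^sub>o a) \<star>\<^sub>o (b \<star>\<^sub>o a)"
    and conjugation: "\<lbrakk>l \<in> L; a \<in> carrier (G l); b \<in> carrier (G l)\<rbrakk> \<Longrightarrow>
          (inv\<^bsub>G l\<^esub> a \<otimes>\<^bsub>G l\<^esub> b) \<star>\<^sub>o a = (b \<otimes>\<^bsub>G l\<^esub> inv\<^bsub>G l\<^esub> a) \<star>\<^sub>u a"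

section \<open>Diagrams\<close>

text \<open>
  A diagram on the sphere (or in the plane) is encoded, as in a planar diagram code, by its
  nodes and the way these are joined by directed pieces of curves, the pieces being named by
  elements of \<open>'e\<close>. The nodes are the crossings, the vertices, and \<^emph>\<open>marks\<close>: a mark
  \<open>Mark i j\<close> is an auxiliary point at which a curve is cut into a piece \<open>i\<close> that ends there
  and a piece \<open>j\<close> that starts there. Marks do not cut semi-arcs (see \<open>semiarc\<close> below); they
  permit a circle without crossings and vertices (\<open>Mark e e\<close>), and they allow a curve to be cut
  where it meets the disk of a move.

  The arguments of the other constructors name the pieces in these pictures:

  \<^item> \<open>PosX ul ur ll lr\<close>, \<open>NegX ul ur ll lr\<close>: a crossing, drawn with both strands directed
    downward, with the pieces at the upper left, upper right, lower left, lower right. The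
    over-strand runs from upper right to lower left in \<open>PosX\<close>, and from upper left to lower right
    in \<open>NegX\<close>.
  \<^item> \<open>Merge ul ur b\<close>: a vertex with incoming pieces from the upper left and the upper right
    and an outgoing piece at the bottom.
  \<^item> \<open>Split t ll lr\<close>: a vertex with an incoming piece from the top and outgoing pieces to the
    lower left and the lower right.

  Every crossing and every vertex of a Y-oriented diagram has, up to rotation, exactly one such
  picture.
\<close>

datatype 'e node =
    Mark 'e 'e
  | PosX 'e 'e 'e 'e
  | NegX 'e 'e 'e 'e
  | Merge 'e 'e 'e
  | Split 'e 'e 'e

text \<open>\<open>In e\<close> is the end of the piece \<open>e\<close> at which \<open>e\<close> runs into a node, \<open>Out e\<close> the end at which
  it leaves a node.\<close>

datatype 'e piece_end = In (piece: 'e) | Out (piece: 'e)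

fun flip :: "'e piece_end \<Rightarrow> 'e piece_end" where
  "flip (In e) = Out e"
| "flip (Out e) = In e"

text \<open>The ends at a node in counterclockwise order.\<close>

fun ends :: "'e node \<Rightarrow> 'e piece_end list" where
  "ends (Mark i j) = [In i, Out j]"
| "ends (PosX ul ur ll lr) = [In ul, Out ll, Out lr, In ur]"
| "ends (NegX ul ur ll lr) = [In ul, Out ll, Out lr, In ur]"
| "ends (Merge ul ur b) = [In ul, Out b, In ur]"
| "ends (Split t ll lr) = [In t, Out ll, Out lr]"

text \<open>The ends that belong to the over-strand of a crossing.\<close>

fun over :: "'e node \<Rightarrow> 'e piece_end \<Rightarrow> bool" where
  "over (PosX ul ur ll lr) h \<longleftrightarrow> h = In ur \<or> h = Out ll"
| "over (NegX ul ur ll lr) h \<longleftrightarrow> h = In ul \<or> h = Out lr"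
| "over _ h \<longleftrightarrow> False"

text \<open>\<open>hs\<close> lists the ends at \<open>n\<close> in counterclockwise order, starting anywhere. Hence a list of
  length 2, 3 or 4 makes \<open>n\<close> a mark, a vertex or a crossing, respectively.\<close>

definition view :: "'e node \<Rightarrow> 'e piece_end list \<Rightarrow> bool"
  where "view n hs \<longleftrightarrow> (\<exists>k. hs = rotate k (ends n))"

definition ends_of :: "'e node multiset \<Rightarrow> 'e piece_end set"
  where "ends_of D = (\<Union>n\<in>set_mset D. set (ends n))"

definition pieces :: "'e node multiset \<Rightarrow> 'e set"
  where "pieces D = piece ` ends_of D"

definition ccw_next :: "'e node multiset \<Rightarrow> ('e piece_end \<times> 'e piece_end) set"
  where "ccw_next D = {(h, k). \<exists>n\<in>#D. \<exists>hs. view n (h # k # hs)}"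

text \<open>The diagrams below have each end at exactly one position of one node; then \<open>ccw_next D\<close> is
  a permutation of the finite set \<open>ends_of D\<close>, and the reflexive transitive closures below are
  equivalence relations on that set. Walking along a piece and turning at its far end to the next
  piece traces out the faces; \<open>components_of D\<close> are the connected components of the underlying
  planar set. The curves lie on the sphere iff Euler's formula holds, the Euler characteristics of
  the spheres carrying the individual components being added up.\<close>

definition faces :: "'e node multiset \<Rightarrow> 'e piece_end set set"
  where "faces D = ends_of D // {(h, k). (flip h, k) \<in> ccw_next D}\<^sup>*"

definition components_of :: "'e node multiset \<Rightarrow> 'e piece_end set set"
  where "components_of D = ends_of D // (ccw_next D \<union> {(h, k). k = flip h})\<^sup>*"

definition planar :: "'e node multiset \<Rightarrow> bool"
  where "planar D \<longleftrightarrow>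
    int (size D) - int (card (pieces D)) + int (card (faces D)) = 2 * int (card (components_of D))"

text \<open>Diagrams of Y-oriented spatial trivalent graphs. That each piece has exactly one initial and
  one terminal end says that the directions at the nodes fit together; the Y-orientation condition
  at the vertices is built into \<open>Merge\<close> and \<open>Split\<close>.\<close>

definition diagram :: "'e node multiset \<Rightarrow> bool"
  where "diagram D \<longleftrightarrow>
    (\<forall>h. count (\<Sum>n\<in>#D. mset (ends n)) h \<le> 1) \<and>
    (\<forall>h\<in>ends_of D. flip h \<in> ends_of D) \<and>
    planar D"

section \<open>Semi-arcs and colorings\<close>

text \<open>A semi-arc is the set of the pieces that form it: pieces that meet at a mark belong to the
  same semi-arc.\<close>

definition same_semiarc :: "'e node multiset \<Rightarrow> ('e \<times> 'e) set"
  where "same_semiarc D = {(i, j). Mark i j \<in># D \<or> Mark j i \<in># D}\<^sup>*"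

definition semiarc :: "'e node multiset \<Rightarrow> 'e \<Rightarrow> 'e set"
  where "semiarc D e = same_semiarc D `` {e}"

definition semiarcs :: "'e node multiset \<Rightarrow> 'e set set"
  where "semiarcs D = semiarc D ` pieces D"

context multiple_conjugation_biquandle
begin

definition tri :: "'x \<Rightarrow> 'x \<Rightarrow> 'x"  (infixl "\<triangle>" 70)
  where "a \<triangle> b = (inv\<^bsub>group_at L G b\<^esub> b \<otimes>\<^bsub>group_at L G b\<^esub> a) \<star>\<^sub>o b"

text \<open>The coloring condition at a node, where \<open>c\<close> gives the color of the semi-arc of a piece.\<close>

fun node_condition :: "('e \<Rightarrow> 'x) \<Rightarrow> 'e node \<Rightarrow> bool" where
  "node_condition c (Mark i j) \<longleftrightarrow> True"
| "node_condition c (PosX ul ur ll lr) \<longleftrightarrow>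
    (\<exists>a\<in>X. \<exists>b\<in>X. c ul = a \<and> c ll = b \<and> c ur = b \<star>\<^sub>o a \<and> c lr = a \<star>\<^sub>u b)"
| "node_condition c (NegX ul ur ll lr) \<longleftrightarrow>
    (\<exists>a\<in>X. \<exists>b\<in>X. c ul = a \<and> c ll = b \<and> c ur = b \<star>\<^sub>u a \<and> c lr = a \<star>\<^sub>o b)"
| "node_condition c (Merge ul ur d) \<longleftrightarrow>
    (\<exists>l\<in>L. \<exists>a\<in>carrier (G l). \<exists>b\<in>carrier (G l). c ul = b \<and> c ur = a \<triangle> b \<and> c d = a)"
| "node_condition c (Split t ll lr) \<longleftrightarrow>
    (\<exists>l\<in>L. \<exists>a\<in>carrier (G l). \<exists>b\<in>carrier (G l). c t = a \<and> c ll = b \<and> c lr = a \<triangle> b)"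

definition coloring :: "'e node multiset \<Rightarrow> ('e set \<Rightarrow> 'x) \<Rightarrow> bool"
  where "coloring D C \<longleftrightarrow>
    C \<in> semiarcs D \<rightarrow>\<^sub>E X \<and> (\<forall>n\<in>#D. node_condition (\<lambda>e. C (semiarc D e)) n)"

end

section \<open>Moves\<close>

text \<open>
  \<open>local_move B P P'\<close>: the part of a diagram inside a disk consists of the nodes \<open>P\<close> before and
  of \<open>P'\<close> after the move (or conversely). \<open>B\<close> is the set of the ends, at nodes inside the disk,
  of the pieces that cross the boundary of the disk; all other pieces occurring in \<open>P\<close> or \<open>P'\<close>
  lie inside the disk and have one end \<open>h\<close> and the other end \<open>flip h\<close> there. A strand without
  crossings and vertices in the disk is marked once inside the disk.

  No directions are prescribed by the pictures: variables like \<open>h\<close> stand for either kind of end,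
  so that each rule covers all Y-orientations of its picture. The lists give the ends at a node
  counterclockwise; at a crossing, the first and the third (the second and the fourth) belong to
  the same strand.

  \<^item> R1: a strand from \<open>h\<close> to \<open>k\<close>; the kink has a loop with ends \<open>l\<close> and \<open>flip l\<close>.
  \<^item> R2: the strand \<open>h1 h2\<close> from top to bottom on the left, \<open>k1 k2\<close> on the right; \<open>c\<close> is the
    upper and \<open>d\<close> the lower crossing. \<open>x\<close>, \<open>y\<close> are the sides of the bigon.
  \<^item> R3: straight strands \<open>a1 a2\<close>, \<open>b1 b2\<close>, \<open>c1 c2\<close> with ends on the boundary at the angles 0, 180;
    60, 240; 120, 300 degrees. In the plane, the crossing of the last two lies to the south of the
    first strand before and to the north of it after the move. The heights of the strands over the
    plane are \<open>ha\<close>, \<open>hb\<close>, \<open>hc\<close>; \<open>x\<close>, \<open>y\<close>, \<open>z\<close>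
    (\<open>x'\<close>, \<open>y'\<close>, \<open>z'\<close>) are the sides of the triangle.
  \<^item> R4: a vertex with ends \<open>h1\<close>, \<open>h2\<close>, \<open>h3\<close>; the second and the third edge cross next to it.
  \<^item> R5: a vertex with ends \<open>h1\<close>, \<open>h2\<close>, \<open>h3\<close> and a strand whose ends \<open>k1\<close>, \<open>k3\<close> lie between the
    third and the first edge, \<open>k1\<close> next to the first. Starting at \<open>k1\<close> it goes around the vertex
    across the three edges in the order \<open>h1\<close>, \<open>h2\<close>, \<open>h3\<close>.
  \<^item> R6: the boundary ends are \<open>p\<close> (upper left), \<open>q\<close> (lower left), \<open>r\<close> (lower right), \<open>s\<close> (upper
    right).
\<close>

inductive local_move :: "'e piece_end set \<Rightarrow> 'e node multiset \<Rightarrow> 'e node multiset \<Rightarrow> bool" where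
  R1: "\<lbrakk>view m [h, k]; view c [h, flip l, l, k]\<rbrakk>
    \<Longrightarrow> local_move {h, k} {#m#} {#c#}"
| R2: "\<lbrakk>view m [h1, h2]; view n [k1, k2];
        view c [h1, y, x, k1]; view d [flip y, h2, k2, flip x];
        over c h1 \<longleftrightarrow> over d h2\<rbrakk>
    \<Longrightarrow> local_move {h1, h2, k1, k2} {#m, n#} {#c, d#}"
| R3: "\<lbrakk>(ha :: nat) \<noteq> hb; hb \<noteq> hc; ha \<noteq> hc;
        view ab [a1, b1, x, y]; view ac [flip x, c1, a2, z]; view bc [flip y, flip z, b2, c2];
        over ab a1 \<longleftrightarrow> hb < ha; over ac a2 \<longleftrightarrow> hc < ha; over bc b2 \<longleftrightarrow> hc < hb;
        view ac' [a1, z', x', c2]; view ab' [flip x', y', a2, b2]; view bc' [b1, c1, flip y', flip z'];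
        over ab' a2 \<longleftrightarrow> hb < ha; over ac' a1 \<longleftrightarrow> hc < ha; over bc' b1 \<longleftrightarrow> hc < hb\<rbrakk>
    \<Longrightarrow> local_move {a1, a2, b1, b2, c1, c2} {#ab, ac, bc#} {#ab', ac', bc'#}"
| R4: "\<lbrakk>view v [h1, h2, h3]; view v' [h1, x, y]; view c [flip x, h2, h3, flip y]\<rbrakk>
    \<Longrightarrow> local_move {h1, h2, h3} {#v#} {#v', c#}"
| R5: "\<lbrakk>view v [h1, h2, h3]; view m [k1, k3];
        view v' [x1, x2, x3];
        view c1 [h1, s, flip x1, k1]; view c2 [h2, t, flip x2, flip s]; view c3 [h3, k3, flip x3, flip t];
        over c1 h1 \<longleftrightarrow> over c2 h2; over c2 h2 \<longleftrightarrow> over c3 h3\<rbrakk>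
    \<Longrightarrow> local_move {h1, h2, h3, k1, k3} {#v, m#} {#v', c1, c2, c3#}"
| R6: "\<lbrakk>view v [p, x, s]; view w [flip x, q, r]; view v' [p, q, y]; view w' [flip y, r, s]\<rbrakk>
    \<Longrightarrow> local_move {p, q, r, s} {#v, w#} {#v', w'#}"

text \<open>\<open>D'\<close> is obtained from \<open>D\<close> by one of the moves, and \<open>E\<close> is the set of the pieces that lie
  outside the disk of the move or cross its boundary. These are common to \<open>D\<close> and \<open>D'\<close>, with the
  same directions; for diagrams \<open>D\<close> and \<open>D'\<close> the pieces inside the disk have names that do not
  occur in \<open>E\<close>.\<close>

definition move :: "'e node multiset \<Rightarrow> 'e node multiset \<Rightarrow> 'e set \<Rightarrow> bool"
  where "move D D' E \<longleftrightarrow>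
    (\<exists>N B P P'. (local_move B P P' \<or> local_move B P' P) \<and>
       D = N + P \<and> D' = N + P' \<and> E = pieces N \<union> piece ` B)"

end

theory Submission
  imports Defs
begin

text \<open>
  If the direction of a piece of color \<open>a\<close> is reversed and \<open>a\<close> is replaced by \<open>a\<^sup>-\<^sup>1 \<star>\<^sub>o a = a\<^sup>-\<^sup>1 \<star>\<^sub>u a\<close>,
  then all conditions at crossings and vertices are preserved, and doing this twice changes nothing.
  So at each node one may pretend that all pieces run into it. A crossing then becomes a relation
  between four colors that is invariant under rotation, in which any two neighboring colors determine
  the other two, and a vertex becomes a relation between three colors that is invariant under
  rotation and merely says that three elements of one group, suitably transported, have product 1.
  With the directions gone, each of R1 to R6 is a single identity: R1 is the bijectivity of
  \<open>x \<mapsto> x \<star>\<^sub>u x\<close>, R2 the invertibility of crossings, R3 the exchange laws, R4 the conjugation axiom,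
  R5 the homomorphism and product axioms, and R6 associativity.
\<close>

text \<open>Reversal depends on a fact that the axioms do not state: group units act trivially. For
  a unit \<open>e\<close> in the group of \<open>b\<close>, the product axiom only gives that
  \<open>e \<star>\<^sub>o b\<close>, the unit of the group of \<open>b \<star>\<^sub>o b\<close>,
  fixes every color of the form \<open>x \<star>\<^sub>o b\<close> or
  \<open>x \<star>\<^sub>u b\<close> under the operation in question. To reach all units one needs
  every color to be some \<open>b \<star>\<^sub>o b\<close>, and this has to be extracted from the
  bijectivity of the pair map. Then acting by a product of \<open>a\<close> and its inverse does
  nothing, and the second factor that the product axiom produces is
  \<open>iv a \<star>\<^sub>o a\<close>: this is the origin of the reversed color. Colorings live on
  semi-arcs, whose extent may change outside the disk when a move is made. The argument therefore
  colors single pieces and treats a mark as a node forcing equal colors; semi-arcs return only at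
  the end. A disk then contributes two local facts: colorings extend from either side of the move to
  the other with the same boundary colors, and the boundary colors determine the interior
  ones.\<close>

context multiple_conjugation_biquandle
begin

section \<open>Arithmetic of colors in the disjoint union of the groups\<close>

definition same :: "'x \<Rightarrow> 'x \<Rightarrow> bool"
  where "same a b \<longleftrightarrow> (\<exists>l\<in>L. a \<in> carrier (G l) \<and> b \<in> carrier (G l))"

text \<open>\<open>mul\<close> and \<open>iv\<close> recover the group from their argument, so that
  labels disappear from later statements. A product is meaningful only for factors related by
  \<open>same\<close>.\<close>

definition mul :: "'x \<Rightarrow> 'x \<Rightarrow> 'x"  (infixl "\<odot>" 75)
  where "a \<odot> b = a \<otimes>\<^bsub>group_at L G a\<^esub> b"

definition iv :: "'x \<Rightarrow> 'x"
  where "iv a = inv\<^bsub>group_at L G a\<^esub> a"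

lemma index_unique:
  "\<lbrakk>l \<in> L; m \<in> L; a \<in> carrier (G l); a \<in> carrier (G m)\<rbrakk> \<Longrightarrow> m = l"
  using disjoint by (auto simp: disjoint_family_on_def)

lemma group_at_eq: "l \<in> L \<Longrightarrow> a \<in> carrier (G l) \<Longrightarrow> group_at L G a = G l"
  unfolding group_at_def by (metis (mono_tags, lifting) index_unique the_equality)

lemma mul_eq: "l \<in> L \<Longrightarrow> a \<in> carrier (G l) \<Longrightarrow> a \<odot> b = a \<otimes>\<^bsub>G l\<^esub> b"
  by (simp add: mul_def group_at_eq)

lemma iv_eq: "l \<in> L \<Longrightarrow> a \<in> carrier (G l) \<Longrightarrow> iv a = inv\<^bsub>G l\<^esub> a"
  by (simp add: iv_def group_at_eq)

lemma sameE:
  assumes "same a b"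
  obtains l where "l \<in> L" "group (G l)" "a \<in> carrier (G l)" "b \<in> carrier (G l)"
  using assms groups unfolding same_def by blast

lemma same_in: "same a b \<Longrightarrow> a \<in> X" "same a b \<Longrightarrow> b \<in> X"
  using union unfolding same_def by auto

lemma same_refl [simp]: "a \<in> X \<Longrightarrow> same a a"
  using union unfolding same_def by auto

lemma same_sym: "same a b \<Longrightarrow> same b a"
  unfolding same_def by blast

lemma same_iff: "\<lbrakk>l \<in> L; a \<in> carrier (G l)\<rbrakk> \<Longrightarrow> same a b \<longleftrightarrow> b \<in> carrier (G l)"
  unfolding same_def using index_unique by blast

lemma same_trans [trans]: "same a b \<Longrightarrow> same b c \<Longrightarrow> same a c"
  by (erule sameE) (simp add: same_iff)

lemma same_iv: "same a b \<Longrightarrow> same a (iv b)"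
  by (auto elim!: sameE simp: same_iff iv_eq group.inv_closed)

lemma same_mul: "same a b \<Longrightarrow> same a c \<Longrightarrow> same a (b \<odot> c)"
  by (erule sameE) (simp add: same_iff mul_eq group.is_monoid monoid.m_closed)

lemma same_mul_right: "same a b \<Longrightarrow> same a (b \<odot> a)"
  by (simp add: same_mul same_in)

lemma mul_assoc:
  assumes "same a b" "same a c"
  shows "(a \<odot> b) \<odot> c = a \<odot> (b \<odot> c)"
proof -
  obtain l where l: "l \<in> L" "group (G l)" "a \<in> carrier (G l)" "b \<in> carrier (G l)"
    using assms(1) by (rule sameE)
  interpret group "G l" by fact
  show ?thesis using l assms by (simp add: mul_eq m_assoc same_iff)
qed

lemma mul_iv_cancel:
  assumes "same a b"
  shows "a \<odot> (iv a \<odot> b) = b" "iv a \<odot> (a \<odot> b) = b" "(b \<odot> a) \<odot> iv a = b" "(b \<odot> iv a) \<odot> a = b"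
    "b \<odot> (iv a \<odot> a) = b"
proof -
  obtain l where l: "l \<in> L" "group (G l)" "a \<in> carrier (G l)" "b \<in> carrier (G l)"
    using assms by (rule sameE)
  interpret group "G l" by fact
  show "a \<odot> (iv a \<odot> b) = b" "iv a \<odot> (a \<odot> b) = b"
    using l by (simp_all add: mul_eq iv_eq flip: m_assoc)
  show "(b \<odot> a) \<odot> iv a = b" "(b \<odot> iv a) \<odot> a = b" "b \<odot> (iv a \<odot> a) = b"
    using l by (simp_all add: mul_eq iv_eq m_assoc)
qed

lemma iv_iv [simp]: "a \<in> X \<Longrightarrow> iv (iv a) = a"
  by (drule same_refl, elim sameE) (simp add: iv_eq)

lemma iv_mul:
  assumes "same a b" shows "iv (a \<odot> b) = iv b \<odot> iv a"
proof -
  obtain l where l: "l \<in> L" "group (G l)" "a \<in> carrier (G l)" "b \<in> carrier (G l)"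
    using assms by (rule sameE)
  interpret group "G l" by fact
  show ?thesis using l by (simp add: mul_eq iv_eq inv_mult_group)
qed

text \<open>\<open>act t x y\<close> is what a color \<open>x\<close> becomes when its strand passes a strand of color \<open>y\<close>, over it
  if \<open>t\<close> holds and under it otherwise.\<close>

definition act :: "bool \<Rightarrow> 'x \<Rightarrow> 'x \<Rightarrow> 'x"
  where "act t x y = (if t then x \<star>\<^sub>o y else x \<star>\<^sub>u y)"

lemma act_bij: "a \<in> X \<Longrightarrow> bij_betw (\<lambda>x. act t x a) X X"
  by (cases t) (simp_all add: act_def bij_us bij_os)

lemma act_in [simp]: "x \<in> X \<Longrightarrow> a \<in> X \<Longrightarrow> act t x a \<in> X"
  using act_bij bij_betwE by fast

lemma act_inj: "\<lbrakk>a \<in> X; x \<in> X; y \<in> X\<rbrakk> \<Longrightarrow> act t x a = act t y a \<longleftrightarrow> x = y"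
  using act_bij[of a t] by (auto simp: bij_betw_def inj_on_def)

lemma act_surj:
  assumes "a \<in> X" "y \<in> X" obtains x where "x \<in> X" "act t x a = y"
proof -
  have "y \<in> (\<lambda>x. act t x a) ` X" using act_bij[OF assms(1)] assms(2) by (simp add: bij_betw_def)
  then show thesis using that by blast
qed

lemma act_diag: "x \<in> X \<Longrightarrow> act t x x = act t' x x"
  using diagonal by (simp add: act_def)

text \<open>\<open>xy\<close> tells whether the strand of \<open>x\<close> runs over that of \<open>y\<close>, and so on; the
  excluded patterns are those that do not come from an ordering of the three strands by height.\<close>

lemma act_exchange:
  assumes "x \<in> X" "y \<in> X" "z \<in> X" "\<not> (xy = yz \<and> xz \<noteq> xy)"
  shows "act xz (act xy x y) (act (\<not> yz) z y) = act xy (act xz x z) (act yz y z)"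
  using assms exchange_uu[of x y z] exchange_uu[of x z y] exchange_uo[of x y z]
    exchange_uo[of x z y] exchange_oo[of x y z] exchange_oo[of x z y]
  by (cases xy; cases yz; cases xz) (simp_all add: act_def)

lemma act_hom:
  assumes "same a b" "x \<in> X"
  shows "same (act t a x) (act t b x)" "act t (a \<odot> b) x = act t a x \<odot> act t b x"
proof -
  obtain l where l: "l \<in> L" "group (G l)" "a \<in> carrier (G l)" "b \<in> carrier (G l)"
    using assms(1) by (rule sameE)
  have a: "a \<in> X" using same_in assms by blast
  have "act t a x \<in> X" using a assms by simp
  then obtain m where m: "m \<in> L" "act t a x \<in> carrier (G m)" using union by auto
  have "(\<lambda>g. act t g x) \<in> hom (G l) (G m)"
    using us_hom[OF a assms(2)] os_hom[OF a assms(2)] l m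
    by (auto simp: act_def group_at_eq split: if_splits)
  then have *: "act t b x \<in> carrier (G m)"
      "act t (a \<otimes>\<^bsub>G l\<^esub> b) x = act t a x \<otimes>\<^bsub>G m\<^esub> act t b x"
    using l by (auto simp: hom_def)
  show "same (act t a x) (act t b x)" using m * by (auto simp: same_def)
  show "act t (a \<odot> b) x = act t a x \<odot> act t b x" using * m l by (simp add: mul_eq)
qed

text \<open>Apply the homomorphism to \<open>a = (a \<odot> iv a) \<odot> a\<close> and cancel in
  the target group.\<close>

lemma act_iv:
  assumes "a \<in> X" "x \<in> X"
  shows "act t (iv a) x = iv (act t a x)"
proof -
  obtain l where l: "l \<in> L" "group (G l)" "a \<in> carrier (G l)"
    using same_refl[OF assms(1)] by (rule sameE)
  interpret l: group "G l" by fact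
  have s: "same a (iv a)" "same a (a \<odot> iv a)" using assms same_iv same_mul by simp_all
  have "act t a x = act t ((a \<odot> iv a) \<odot> a) x"
    using l by (simp add: mul_eq iv_eq)
  then have *: "act t a x = act t a x \<odot> act t (iv a) x \<odot> act t a x"
    using s s[THEN same_sym] assms by (simp add: act_hom)
  obtain m where m: "m \<in> L" "group (G m)" "act t a x \<in> carrier (G m)" "act t (iv a) x \<in> carrier (G m)"
    using act_hom(1)[OF s(1) assms(2)] by (rule sameE)
  interpret m: group "G m" by fact
  have "act t a x \<otimes>\<^bsub>G m\<^esub> act t (iv a) x = \<one>\<^bsub>G m\<^esub>"
    using * m by (simp add: mul_eq)
  then show ?thesis
    using m.inv_equality[OF m.inv_comm] m by (simp add: iv_eq)
qed

lemma act_mul: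
  assumes "same a b" "x \<in> X"
  shows "act t x (a \<odot> b) = act t (act t x a) (act True b a)"
  using assms us_mult os_mult by (auto simp: act_def mul_eq elim!: sameE)

lemma act_conj:
  assumes "same a b"
  shows "act True (iv a \<odot> b) a = act False (b \<odot> iv a) a"
proof -
  obtain l where l: "l \<in> L" "group (G l)" "a \<in> carrier (G l)" "b \<in> carrier (G l)"
    using assms by (rule sameE)
  interpret group "G l" by fact
  show ?thesis using conjugation[of l a b] l by (simp add: act_def mul_eq iv_eq)
qed

text \<open>The conjugation axiom at \<open>b = g \<odot> h\<close>: trading
  \<open>\<star>\<^sub>o g\<close> for \<open>\<star>\<^sub>u g\<close> costs a conjugation by
  \<open>g\<close>. The next lemma is the trade in the other direction.\<close>

lemma act_conj_right:
  assumes "same g h"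
  shows "act True h g = act False ((g \<odot> h) \<odot> iv g) g"
  using act_conj[of g "g \<odot> h"] assms by (simp add: mul_iv_cancel same_mul same_in)

lemma act_conj_left:
  assumes "same g h"
  shows "act False h g = act True (iv g \<odot> (h \<odot> g)) g"
  using act_conj[of g "h \<odot> g"] assms by (simp add: mul_iv_cancel same_mul_right)

section \<open>Diagonal elements and units\<close>

text \<open>Only the diagonal is sent to the diagonal by the pair map. The exchange law with third
  element \<open>x\<close> turns the hypothesis into an equation between two values of
  \<open>\<star>\<^sub>u (x \<star>\<^sub>u y)\<close>; cancelling gives
  \<open>x \<star>\<^sub>u y = x \<star>\<^sub>u x\<close>, and the diagonal axiom lets
  \<open>x\<close> be cancelled once more.\<close>

lemma act_cross_eq:
  assumes "x \<in> X" "y \<in> X" "act t x y = act (\<not> t) y x"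
  shows "x = y"
proof -
  have *: "x = y" if "x \<in> X" "y \<in> X" "x \<star>\<^sub>u y = y \<star>\<^sub>o x" for x y
  proof -
    have w: "x \<star>\<^sub>u y \<in> X" "x \<star>\<^sub>u x \<in> X" using act_in[of x y False] act_in[of x x False] that by (simp_all add: act_def)
    have "(x \<star>\<^sub>u y) \<star>\<^sub>u (x \<star>\<^sub>u y) = (x \<star>\<^sub>u x) \<star>\<^sub>u (x \<star>\<^sub>u y)"
      using exchange_uu[OF that(1,2,1)] by (simp only: that(3))
    then have "x \<star>\<^sub>u y = x \<star>\<^sub>u x"
      using act_inj[of "x \<star>\<^sub>u y" "x \<star>\<^sub>u y" "x \<star>\<^sub>u x" False] w by (simp add: act_def)
    then show "x = y"
      using act_inj[of x x y True] that diagonal by (simp add: act_def)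
  qed
  show ?thesis
  proof (cases t)
    case True
    with assms *[of y x] show ?thesis by (simp add: act_def)
  next
    case False
    with assms *[of x y] show ?thesis by (simp add: act_def)
  qed
qed

text \<open>The preimage of \<open>(z, z)\<close> under the pair map lies on the diagonal by
  \<open>act_cross_eq\<close>.\<close>

lemma act_diag_surj:
  assumes "z \<in> X" obtains x where "x \<in> X" "act t x x = z"
proof -
  have "(z, z) \<in> (\<lambda>(x, y). (y \<star>\<^sub>o x, x \<star>\<^sub>u y)) ` (X \<times> X)"
    using bij_pair assms by (simp add: bij_betw_def)
  then obtain x y where xy: "x \<in> X" "y \<in> X" "y \<star>\<^sub>o x = z" "x \<star>\<^sub>u y = z" by auto
  then have "x = y" using act_cross_eq[of x y False] by (simp add: act_def)
  with xy show thesis using that[of x] diagonal by (cases t) (simp_all add: act_def)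
qed

lemma act_diag_inj:
  assumes "x \<in> X" "y \<in> X" "act t x x = act t y y"
  shows "x = y"
proof -
  have "x \<star>\<^sub>o x = y \<star>\<^sub>o y" "x \<star>\<^sub>u x = y \<star>\<^sub>u y"
    using assms(3) act_diag[OF assms(1), of t] act_diag[OF assms(2), of t]
    by (metis act_def)+
  then have "(\<lambda>(x, y). (y \<star>\<^sub>o x, x \<star>\<^sub>u y)) (x, x) = (\<lambda>(x, y). (y \<star>\<^sub>o x, x \<star>\<^sub>u y)) (y, y)" by simp
  then have "(x, x) = (y, y)"
    by (rule inj_onD[OF bij_betw_imp_inj_on[OF bij_pair]]) (simp_all add: assms)
  then show ?thesis by simp
qed

text \<open>Writing \<open>a = b \<star>\<^sub>o b\<close> makes the unit at \<open>a\<close> the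
  image of the unit at \<open>b\<close>. With \<open>x\<close> written as \<open>act t y b\<close>,
  the product law for \<open>b\<close> times its unit then says exactly that the unit at
  \<open>a\<close> fixes \<open>x\<close>.\<close>

lemma act_unit:
  assumes "a \<in> X" "x \<in> X"
  shows "act t x (iv a \<odot> a) = x"
proof -
  obtain b where b: "b \<in> X" "act True b b = a" by (rule act_diag_surj[OF assms(1)])
  obtain y where y: "y \<in> X" "act t y b = x" by (rule act_surj[OF b(1) assms(2)])
  have s: "same b (iv b)" "same b (iv b \<odot> b)" "same (iv b) b"
    using b same_iv[of b b] same_sym[OF same_iv[of b b]] by (simp_all add: same_mul)
  have "act t y (b \<odot> (iv b \<odot> b)) = act t x (act True (iv b \<odot> b) b)"
    using act_mul[OF s(2) y(1)] y by simp
  moreover have "act True (iv b \<odot> b) b = iv a \<odot> a"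
    using act_hom(2)[OF s(3) b(1), of True] act_iv[OF b(1) b(1), of True] b(2) by simp
  moreover have "b \<odot> (iv b \<odot> b) = b" using b mul_iv_cancel(5) by simp
  ultimately show ?thesis using y by simp
qed

text \<open>A group is recognized by its unit: the images of the two units coincide, hence so do the
  units, because acting by \<open>x\<close> is injective.\<close>

lemma act_reflects_same:
  assumes "a \<in> X" "b \<in> X" "x \<in> X" "same (act t a x) (act t b x)"
  shows "same a b"
proof -
  have s: "same a (iv a)" "same b (iv b)" using assms same_iv by simp_all
  have unit: "iv c \<odot> c = iv d \<odot> d" if "same c d" for c d
    using that by (elim sameE) (simp add: mul_eq iv_eq group.inv_closed group.l_inv)
  have "act t (iv a \<odot> a) x = act t (iv b \<odot> b) x"
    using unit[OF assms(4)] s[THEN same_sym] assms by (simp add: act_hom act_iv)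
  moreover have sa: "same a (iv a \<odot> a)" and sb: "same b (iv b \<odot> b)"
    using s assms same_mul by simp_all
  ultimately have "iv a \<odot> a = iv b \<odot> b"
    using act_inj[OF assms(3)] same_in(2) by blast
  then show ?thesis using same_trans[OF sa] same_sym[OF sb] by simp
qed

lemma act_mul_reflect:
  assumes "a \<in> X" "x \<in> X" "same (act t a x) b"
  obtains c where "same a c" "b = act t c x"
proof -
  obtain c where "c \<in> X" "act t c x = b"
    by (rule act_surj[OF assms(2) same_in(2)[OF assms(3)]])
  note c = this
  have "same a c" using assms(3) by (intro act_reflects_same[OF assms(1) c(1) assms(2), of t]) (simp only: c(2))
  with c show thesis using that by (simp only: c(2))
qed

section \<open>Reversing the direction of a piece\<close>

text \<open>The color of a piece after its direction has been reversed.\<close>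

definition opp :: "'x \<Rightarrow> 'x"
  where "opp a = act True (iv a) a"

lemma iv_in [simp]: "a \<in> X \<Longrightarrow> iv a \<in> X"
  by (rule same_in(2)[OF same_iv[OF same_refl]])

lemma opp_in [simp]: "a \<in> X \<Longrightarrow> opp a \<in> X"
  by (simp add: opp_def)

text \<open>Since \<open>iv a\<close> commutes with \<open>a\<close>, the conjugation in
  \<open>act_conj_left\<close> is trivial, so a reversed color does not depend on over and
  under.\<close>

lemma opp_eq: "a \<in> X \<Longrightarrow> opp a = act t (iv a) a"
proof (cases t)
  case False
  assume "a \<in> X"
  then have "same a (iv a)" by (simp add: same_iv)
  from act_conj_left[OF this] mul_iv_cancel(5)[OF this] False show ?thesis by (simp add: opp_def)
qed (simp add: opp_def)

text \<open>The product law for \<open>a \<odot> iv a\<close>, which acts trivially, has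
  \<open>opp a\<close> as its second factor.\<close>

lemma act_opp:
  assumes "a \<in> X" "x \<in> X"
  shows "act t (act t x a) (opp a) = x"
proof -
  have "act t x (a \<odot> iv a) = act t (act t x a) (opp a)"
    unfolding opp_def using assms by (intro act_mul same_iv same_refl)
  moreover have "act t x (a \<odot> iv a) = x" using act_unit[of "iv a" x t] assms by simp
  ultimately show ?thesis by simp
qed

lemma opp_opp [simp]:
  assumes "a \<in> X" shows "opp (opp a) = a"
proof -
  have "iv (opp a) = act True a a"
    unfolding opp_def act_iv[OF iv_in[OF assms] assms, symmetric] iv_iv[OF assms] ..
  then have "opp (opp a) = act True (act True a a) (opp a)" by (simp only: opp_def[of "opp a"])
  then show ?thesis using act_opp[OF assms assms] by simp
qed

lemma opp_inj:
  assumes "a \<in> X" "b \<in> X" shows "opp a = opp b \<longleftrightarrow> a = b"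
proof
  assume "opp a = opp b"
  then have "opp (opp a) = opp (opp b)" by (rule arg_cong)
  then show "a = b" using assms by simp
qed simp

lemma act_opp':
  assumes "a \<in> X" "x \<in> X"
  shows "act t (act t x (opp a)) a = x"
  using act_opp[of "opp a" x t] assms by simp

text \<open>The exchange law for \<open>iv p\<close>, \<open>q\<close>, \<open>p\<close>. It says
  that reversing the strand of \<open>p\<close> is compatible with its passing
  \<open>q\<close>.\<close>

lemma opp_act:
  assumes "p \<in> X" "q \<in> X"
  shows "opp (act t p q) = act t (opp p) (act (\<not> t) q p)"
proof -
  have "opp (act t p q) = act (\<not> t) (act t (iv p) q) (act t p q)"
    using assms opp_eq[of "act t p q" "\<not> t"] by (simp add: act_iv)
  also have "\<dots> = act t (act (\<not> t) (iv p) p) (act (\<not> t) q p)"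
    using act_exchange[of "iv p" q p t "\<not> t" "\<not> t"] assms by simp
  finally show ?thesis using assms opp_eq[of p "\<not> t"] by simp
qed

text \<open>The condition at a crossing with inward colors \<open>a\<close>, \<open>b\<close>, \<open>c\<close>, \<open>d\<close> in counterclockwise order, where
  the strand of \<open>a\<close> and \<open>c\<close> is the over-strand iff \<open>t\<close> holds.\<close>

definition cross :: "bool \<Rightarrow> 'x \<Rightarrow> 'x \<Rightarrow> 'x \<Rightarrow> 'x \<Rightarrow> bool"
  where "cross t a b c d \<longleftrightarrow>
    a \<in> X \<and> b \<in> X \<and> c = opp (act t a (opp b)) \<and> d = act (\<not> t) (opp b) a"

text \<open>A quarter turn puts the other strand first, hence the negated \<open>t\<close>. The
  color \<open>a\<close> returns because passing \<open>opp b\<close> and then \<open>b\<close>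
  cancels; the value of \<open>d\<close> comes from \<open>opp_act\<close>.\<close>

lemma cross_rotate:
  assumes "cross t a b c d"
  shows "cross (\<not> t) b c d a"
  using assms opp_act[of b "act t a (opp b)" "\<not> t"] by (simp add: cross_def act_opp')

lemma cross_rotate_iff:
  "cross t a b c d \<longleftrightarrow> cross (\<not> t) b c d a"
  "cross t a b c d \<longleftrightarrow> cross t c d a b"
  "cross t a b c d \<longleftrightarrow> cross (\<not> t) d a b c"
  using cross_rotate[of t a b c d] cross_rotate[of "\<not> t" b c d a] cross_rotate[of t c d a b]
    cross_rotate[of "\<not> t" d a b c] by auto

text \<open>The condition at a vertex with inward colors \<open>a\<close>, \<open>b\<close>, \<open>c\<close> in clockwise order. It says that \<open>a = g\<close>,
  \<open>b = h \<star>\<^sub>o g\<close> and \<open>c = k \<star>\<^sub>o (g \<odot> h)\<close> where \<open>g\<close>, \<open>h\<close>, \<open>k\<close> have product 1.\<close>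

definition vert :: "'x \<Rightarrow> 'x \<Rightarrow> 'x \<Rightarrow> bool"
  where "vert a b c \<longleftrightarrow> (\<exists>g h. same g h \<and> a = g \<and> b = act True h g \<and> c = opp (g \<odot> h))"

text \<open>With \<open>k = iv (g \<odot> h)\<close>, the new factors are \<open>h\<close> and
  \<open>k\<close>, both transported by \<open>g\<close>. The product law splits \<open>c\<close>,
  which is \<open>k\<close> acted on by \<open>g \<odot> h\<close>, and
  \<open>h \<odot> k = iv g\<close> closes the cycle.\<close>

lemma vert_rotate:
  assumes "vert a b c"
  shows "vert b c a"
proof -
  obtain g h where gh: "same g h" "a = g" "b = act True h g" "c = opp (g \<odot> h)"
    using assms by (auto simp: vert_def)
  have X: "g \<in> X" "h \<in> X" by (rule same_in[OF gh(1)])+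
  have hg: "same h g" by (rule same_sym[OF gh(1)])
  have s: "same h (g \<odot> h)" by (rule same_mul[OF hg same_refl[OF X(2)]])
  let ?i = "iv (g \<odot> h)"
  have i: "same h ?i" by (rule same_iv[OF s])
  have "same b (act True ?i g)" unfolding gh(3) by (rule act_hom(1)[OF i X(1)])
  moreover have "c = act True (act True ?i g) b"
    unfolding gh(3,4) opp_def by (rule act_mul[OF gh(1) same_in(2)[OF i]])
  moreover have "a = opp (b \<odot> act True ?i g)"
  proof -
    have "h \<odot> ?i = iv g"
      unfolding iv_mul[OF gh(1)] by (rule mul_iv_cancel(1)[OF same_iv[OF hg]])
    then have "b \<odot> act True ?i g = opp g"
      unfolding gh(3) opp_def act_hom(2)[OF i X(1), symmetric] by simp
    then show ?thesis using gh(2) X by simp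
  qed
  ultimately show ?thesis unfolding vert_def by blast
qed

lemma vert_rotate_iff: "vert a b c \<longleftrightarrow> vert b c a" "vert a b c \<longleftrightarrow> vert c a b"
  using vert_rotate[of a b c] vert_rotate[of b c a] vert_rotate[of c a b] by argo+

section \<open>Node conditions without directions\<close>

text \<open>The color of the piece at an end, the piece being redirected so that it runs into the node.\<close>

fun inw :: "('e \<Rightarrow> 'x) \<Rightarrow> 'e piece_end \<Rightarrow> 'x" where
  "inw c (In e) = c e"
| "inw c (Out e) = opp (c e)"

lemma inw_flip: "c (piece h) \<in> X \<Longrightarrow> inw c (flip h) = opp (inw c h)"
  by (cases h) simp_all

lemma inw_in: "c (piece h) \<in> X \<Longrightarrow> inw c h \<in> X"
  by (cases h) simp_all

lemma inw_inj: "\<lbrakk>c (piece h) \<in> X; c' (piece h) \<in> X\<rbrakk> \<Longrightarrow> inw c h = inw c' h \<longleftrightarrow> c (piece h) = c' (piece h)"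
  by (cases h) (simp_all add: opp_inj)

text \<open>\<open>node_condition\<close> asks nothing at a mark because its pieces share a
  semi-arc; for colors of pieces the equality must be demanded. Membership in \<open>X\<close> is
  included because \<open>opp\<close> is an involution only there.\<close>

definition sat :: "('e \<Rightarrow> 'x) \<Rightarrow> 'e node \<Rightarrow> bool"
  where "sat c n \<longleftrightarrow> (\<forall>h\<in>set (ends n). c (piece h) \<in> X) \<and> node_condition c n \<and>
    (\<forall>i j. n = Mark i j \<longrightarrow> c i = c j)"

lemma sat_Mark: "sat c (Mark i j) \<longleftrightarrow> c i \<in> X \<and> c j \<in> X \<and> inw c (Out j) = opp (inw c (In i))"
  by (auto simp: sat_def opp_inj)

lemma sat_PosX:
  "sat c (PosX ul ur ll lr) \<longleftrightarrow> c ul \<in> X \<and> c ur \<in> X \<and> c ll \<in> X \<and> c lr \<in> X \<and>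
     cross False (inw c (In ul)) (inw c (Out ll)) (inw c (Out lr)) (inw c (In ur))"
proof -
  have "node_condition c (PosX ul ur ll lr) \<longleftrightarrow>
      c ul \<in> X \<and> c ll \<in> X \<and> c ur = act True (c ll) (c ul) \<and> c lr = act False (c ul) (c ll)"
    by (auto simp: act_def)
  then show ?thesis by (auto simp: sat_def cross_def opp_inj simp del: node_condition.simps)
qed

lemma sat_NegX:
  "sat c (NegX ul ur ll lr) \<longleftrightarrow> c ul \<in> X \<and> c ur \<in> X \<and> c ll \<in> X \<and> c lr \<in> X \<and>
     cross True (inw c (In ul)) (inw c (Out ll)) (inw c (Out lr)) (inw c (In ur))"
proof -
  have "node_condition c (NegX ul ur ll lr) \<longleftrightarrow>
      c ul \<in> X \<and> c ll \<in> X \<and> c ur = act False (c ll) (c ul) \<and> c lr = act True (c ul) (c ll)"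
    by (auto simp: act_def)
  then show ?thesis by (auto simp: sat_def cross_def opp_inj simp del: node_condition.simps)
qed

lemma tri_eq:
  assumes "same a b"
  shows "a \<triangle> b = act True (iv b \<odot> a) b"
  using assms by (elim sameE) (simp add: tri_def group_at_eq mul_eq iv_eq act_def group.inv_closed)

lemma vert_iff_tri:
  assumes "c \<in> X"
  shows "vert a b (opp c) \<longleftrightarrow> same c a \<and> b = c \<triangle> a"
proof
  assume "vert a b (opp c)"
  then obtain h where h: "same a h" "b = act True h a" "opp c = opp (a \<odot> h)"
    by (auto simp: vert_def)
  have s: "same a (a \<odot> h)" using h(1) same_in(1)[OF h(1)] by (simp add: same_mul)
  have c: "c = a \<odot> h" using h(3) opp_inj[OF assms same_in(2)[OF s]] by simp
  then show "same c a \<and> b = c \<triangle> a"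
    using same_sym[OF s] h(1,2) by (simp add: tri_eq mul_iv_cancel)
next
  assume *: "same c a \<and> b = c \<triangle> a"
  then have s: "same a c" using same_sym by blast
  then have "same a (iv a \<odot> c)" "a \<odot> (iv a \<odot> c) = c"
    using same_iv[OF same_refl[OF same_in(1)[OF s]]] by (simp_all add: same_mul mul_iv_cancel)
  then show "vert a b (opp c)"
    using * tri_eq[of c a] unfolding vert_def by (intro exI[of _ a] exI[of _ "iv a \<odot> c"]) simp
qed

lemma tri_in:
  assumes "same a b" shows "a \<triangle> b \<in> X"
proof -
  have "same b (iv b \<odot> a)"
    using same_iv[OF same_refl[OF same_in(2)[OF assms]]] same_sym[OF assms] by (rule same_mul)
  then show ?thesis unfolding tri_eq[OF assms] using same_in by (intro act_in) blast+
qed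

lemma sat_Merge:
  "sat c (Merge ul ur d) \<longleftrightarrow> c ul \<in> X \<and> c ur \<in> X \<and> c d \<in> X \<and>
     vert (inw c (In ul)) (inw c (In ur)) (inw c (Out d))"
proof -
  have "node_condition c (Merge ul ur d) \<longleftrightarrow> same (c d) (c ul) \<and> c ur = c d \<triangle> c ul"
    by (auto simp: same_def)
  then show ?thesis by (auto simp: sat_def vert_iff_tri simp del: node_condition.simps)
qed

text \<open>Exchanging the arguments of \<open>\<triangle>\<close> reverses its value, by the
  product law for \<open>b \<odot> (iv b \<odot> a) = a\<close>. This is what lets a
  \<open>Split\<close> satisfy the same cyclic relation as a \<open>Merge\<close>.\<close>

lemma vert_reverse:
  assumes "a \<in> X" "b \<in> X" "t \<in> X"
  shows "vert a (opp t) (opp b) \<longleftrightarrow> vert b t (opp a)"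
proof -
  have *: "opp (a \<triangle> b) = b \<triangle> a" if "same a b" for a b
  proof -
    have X: "a \<in> X" "b \<in> X" by (rule same_in[OF that])+
    have ba: "same b a" by (rule same_sym[OF that])
    have s: "same a (iv b)" "same b (iv b)" "same a (iv a)"
      using that X same_iv by simp_all
    have s1: "same b (iv b \<odot> a)" by (rule same_mul[OF s(2) ba])
    have s2: "same a (iv a \<odot> b)" by (rule same_mul[OF s(3) that])
    have s3: "same b (iv a \<odot> b)" by (rule same_trans[OF ba s2])
    have X1: "iv b \<odot> a \<in> X" "iv a \<odot> b \<in> X" using s1 s2 same_in by blast+
    have "iv (iv b \<odot> a) = iv a \<odot> b"
      using iv_mul[OF same_sym[OF s(1)]] X by simp
    then have "opp (act True (iv b \<odot> a) b) = act True (act True (iv a \<odot> b) b) (act True (iv b \<odot> a) b)"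
      using act_iv[OF X1(1) X(2), of True] by (simp add: opp_def)
    also have "\<dots> = act True (iv a \<odot> b) (b \<odot> (iv b \<odot> a))"
      by (rule act_mul[OF s1 X1(2), symmetric])
    also have "\<dots> = act True (iv a \<odot> b) a"
      using mul_iv_cancel(1)[OF ba] by simp
    finally show ?thesis using that ba by (simp add: tri_eq)
  qed
  have "same b a \<and> opp t = b \<triangle> a \<longleftrightarrow> same a b \<and> t = a \<triangle> b"
  proof
    assume "same b a \<and> opp t = b \<triangle> a"
    then have "same a b" "opp t = b \<triangle> a" using same_sym by blast+
    with *[of a b] have "opp t = opp (a \<triangle> b)" by (simp only:)
    with \<open>same a b\<close> show "same a b \<and> t = a \<triangle> b"
      using opp_inj[OF assms(3) tri_in[OF \<open>same a b\<close>]] by blast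
  next
    assume "same a b \<and> t = a \<triangle> b"
    then show "same b a \<and> opp t = b \<triangle> a" using *[of a b] same_sym by blast
  qed
  then show ?thesis using assms by (simp add: vert_iff_tri)
qed

lemma sat_Split:
  "sat c (Split t ll lr) \<longleftrightarrow> c t \<in> X \<and> c ll \<in> X \<and> c lr \<in> X \<and>
     vert (inw c (In t)) (inw c (Out lr)) (inw c (Out ll))"
proof -
  have "node_condition c (Split t ll lr) \<longleftrightarrow> same (c t) (c ll) \<and> c lr = c t \<triangle> c ll"
    by (auto simp: same_def)
  moreover have "vert (c t) (opp (c lr)) (opp (c ll)) \<longleftrightarrow> same (c t) (c ll) \<and> c lr = c t \<triangle> c ll"
    if "c t \<in> X" "c ll \<in> X" "c lr \<in> X"
    using vert_reverse[of "c t" "c ll" "c lr"] vert_iff_tri[of "c t"] that by blast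
  ultimately show ?thesis by (auto simp: sat_def simp del: node_condition.simps)
qed

section \<open>Reading a node from any of its ends\<close>

lemma rotate_3: "rotate k [a, b, c] \<in> {[a, b, c], [b, c, a], [c, a, b]}"
proof (induction k)
  case (Suc k)
  then show ?case unfolding rotate_Suc by (elim insertE) simp_all
qed simp

lemma rotate_4: "rotate k [a, b, c, d] \<in> {[a, b, c, d], [b, c, d, a], [c, d, a, b], [d, a, b, c]}"
proof (induction k)
  case (Suc k)
  then show ?case unfolding rotate_Suc by (elim insertE) simp_all
qed simp

lemma rotate_2: "rotate k [a, b] \<in> {[a, b], [b, a]}"
proof (induction k)
  case (Suc k)
  then show ?case unfolding rotate_Suc by (elim insertE) simp_all
qed simp

lemma view_cases:
  "view n hs \<Longrightarrow> ends n = [a, b] \<Longrightarrow> hs \<in> {[a, b], [b, a]}"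
  "view n hs \<Longrightarrow> ends n = [a, b, c] \<Longrightarrow> hs \<in> {[a, b, c], [b, c, a], [c, a, b]}"
  "view n hs \<Longrightarrow> ends n = [a, b, c, d] \<Longrightarrow>
    hs \<in> {[a, b, c, d], [b, c, d, a], [c, d, a, b], [d, a, b, c]}"
  unfolding view_def by (elim exE, simp only: rotate_2 rotate_3 rotate_4)+

lemma mset_rotate: "mset (rotate k xs) = mset xs"
proof (induction k)
  case (Suc k)
  then show ?case by (cases "rotate k xs") simp_all
qed simp

lemma view_mset: "view n hs \<Longrightarrow> mset (ends n) = mset hs"
  unfolding view_def using mset_rotate by metis

lemma view_length: "view n hs \<Longrightarrow> length (ends n) = length hs"
  using view_mset mset_eq_length by blast

lemma view_set: "view n hs \<Longrightarrow> set (ends n) = set hs"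
  using view_mset mset_eq_setD by blast

lemma sat_view_mark:
  assumes "view n [h, k]"
  shows "sat c n \<longleftrightarrow> c (piece h) \<in> X \<and> c (piece k) \<in> X \<and> inw c k = opp (inw c h)"
proof -
  obtain i j where n: "n = Mark i j" using view_length[OF assms] by (cases n) auto
  have "[h, k] \<in> {[In i, Out j], [Out j, In i]}"
    by (rule view_cases(1)[OF assms]) (simp add: n)
  moreover have "inw c (Out j) = opp (inw c (In i)) \<longleftrightarrow> inw c (In i) = opp (inw c (Out j))"
    if "c i \<in> X" "c j \<in> X" using that by (auto simp: opp_inj)
  ultimately show ?thesis unfolding n sat_Mark by auto
qed

lemma sat_view_vertex:
  assumes "view n [h1, h2, h3]"
  shows "sat c n \<longleftrightarrow> c (piece h1) \<in> X \<and> c (piece h2) \<in> X \<and> c (piece h3) \<in> X \<and>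
    vert (inw c h1) (inw c h3) (inw c h2)"
proof -
  have *: ?thesis if e: "ends n = [a, b, d]"
    and s: "sat c n \<longleftrightarrow> c (piece a) \<in> X \<and> c (piece b) \<in> X \<and> c (piece d) \<in> X \<and>
      vert (inw c a) (inw c d) (inw c b)" for a b d
  proof -
    have "[h1, h2, h3] \<in> {[a, b, d], [b, d, a], [d, a, b]}"
      by (rule view_cases(2)[OF assms e])
    then show ?thesis
      using s vert_rotate_iff[of "inw c a" "inw c d" "inw c b"] by auto
  qed
  show ?thesis
  proof (cases n)
    case (Merge ul ur d)
    then show ?thesis by (intro *) (auto simp: sat_Merge)
  next
    case (Split t ll lr)
    then show ?thesis by (intro *) (auto simp: sat_Split)
  qed (use view_length[OF assms] in auto)
qed

text \<open>\<open>over\<close> recognizes an end by name, not by position; distinctness of the ends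
  makes the two agree, so that rotating the view alternates between the strands.\<close>

lemma view_crossing:
  assumes "view n [h1, h2, h3, h4]" "distinct [h1, h2, h3, h4]"
  shows "over n h2 \<longleftrightarrow> \<not> over n h1" "over n h3 \<longleftrightarrow> over n h1"
    "sat c n \<longleftrightarrow> c (piece h1) \<in> X \<and> c (piece h2) \<in> X \<and> c (piece h3) \<in> X \<and> c (piece h4) \<in> X \<and>
      cross (over n h1) (inw c h1) (inw c h2) (inw c h3) (inw c h4)"
proof -
  let ?P = "(over n h2 \<longleftrightarrow> \<not> over n h1) \<and> (over n h3 \<longleftrightarrow> over n h1) \<and>
    (sat c n \<longleftrightarrow> c (piece h1) \<in> X \<and> c (piece h2) \<in> X \<and> c (piece h3) \<in> X \<and> c (piece h4) \<in> X \<and>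
      cross (over n h1) (inw c h1) (inw c h2) (inw c h3) (inw c h4))"
  have *: ?P if e: "ends n = [a, b, d, e]"
    and o: "over n a = t" "over n b = (\<not> t)" "over n d = t" "over n e = (\<not> t)"
    and s: "sat c n \<longleftrightarrow> c (piece a) \<in> X \<and> c (piece b) \<in> X \<and> c (piece d) \<in> X \<and> c (piece e) \<in> X \<and>
      cross t (inw c a) (inw c b) (inw c d) (inw c e)" for a b d e t
  proof -
    have "[h1, h2, h3, h4] \<in> {[a, b, d, e], [b, d, e, a], [d, e, a, b], [e, a, b, d]}"
      by (rule view_cases(3)[OF assms(1) e])
    then show ?thesis
      using s o cross_rotate_iff[of t "inw c a" "inw c b" "inw c d" "inw c e"] by auto
  qed
  have d: "distinct (ends n)"
    using assms by (metis distinct_rotate view_def)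
  have ?P
  proof (cases n)
    case (PosX ul ur ll lr)
    show ?thesis
      by (rule *[of "In ul" "Out ll" "Out lr" "In ur" False]) (use PosX d in \<open>auto simp: sat_PosX\<close>)
  next
    case (NegX ul ur ll lr)
    show ?thesis
      by (rule *[of "In ul" "Out ll" "Out lr" "In ur" True]) (use NegX d in \<open>auto simp: sat_NegX\<close>)
  qed (use view_length[OF assms(1)] in auto)
  then show "over n h2 \<longleftrightarrow> \<not> over n h1" "over n h3 \<longleftrightarrow> over n h1"
    "sat c n \<longleftrightarrow> c (piece h1) \<in> X \<and> c (piece h2) \<in> X \<and> c (piece h3) \<in> X \<and> c (piece h4) \<in> X \<and>
      cross (over n h1) (inw c h1) (inw c h2) (inw c h3) (inw c h4)" by blast+
qed

text \<open>Prescribes the inward color at \<open>h\<close>, whichever way the piece is directed;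
  the other end of the piece then shows \<open>opp v\<close>.\<close>

definition put :: "'e piece_end \<Rightarrow> 'x \<Rightarrow> ('e \<Rightarrow> 'x) \<Rightarrow> 'e \<Rightarrow> 'x"
  where "put h v c = c(piece h := (case h of In e \<Rightarrow> v | Out e \<Rightarrow> opp v))"

lemma piece_eq_iff: "piece h = piece k \<longleftrightarrow> h = k \<or> h = flip k"
  by (cases h; cases k) auto

lemma flip_flip [simp]: "flip (flip h) = h"
  by (cases h) simp_all

lemma piece_flip [simp]: "piece (flip h) = piece h"
  by (cases h) simp_all

lemma put_other: "piece k \<noteq> piece h \<Longrightarrow> put h v c (piece k) = c (piece k)"
  by (simp add: put_def)

lemma put_in: "v \<in> X \<Longrightarrow> put h v c (piece h) \<in> X"
  by (cases h) (simp_all add: put_def)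

lemma inw_put: "v \<in> X \<Longrightarrow> inw (put h v c) h = v" "v \<in> X \<Longrightarrow> inw (put h v c) (flip h) = opp v"
  by (cases h; simp add: put_def)+

lemma inw_put_other: "piece k \<noteq> piece h \<Longrightarrow> inw (put h v c) k = inw c k"
  by (cases k) (auto simp: put_def)

section \<open>The moves on the level of colors\<close>

lemma cross_in: "cross t a b c d \<Longrightarrow> a \<in> X \<and> b \<in> X \<and> c \<in> X \<and> d \<in> X"
  by (auto simp: cross_def)

lemma cross_exists: "\<lbrakk>a \<in> X; b \<in> X\<rbrakk> \<Longrightarrow> \<exists>c\<in>X. \<exists>d\<in>X. cross t a b c d"
  by (auto simp: cross_def)

lemma cross_determ: "\<lbrakk>cross t a b c d; cross t a b c' d'\<rbrakk> \<Longrightarrow> c = c' \<and> d = d'"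
  by (simp add: cross_def)

text \<open>Read from the loop, both arguments of \<open>act\<close> are \<open>opp w\<close>. By
  the diagonal axiom the type of the crossing no longer matters, so \<open>t\<close> is absent on
  the right.\<close>

lemma cross_loop:
  assumes "w \<in> X"
  shows "cross t h (opp w) w k \<longleftrightarrow> h = act True (opp w) (opp w) \<and> k = opp h"
proof -
  have "act (\<not> t) (opp w) (opp w) = act True (opp w) (opp w)" "act t (opp w) (opp w) = act True (opp w) (opp w)"
    by (rule act_diag, simp add: assms)+
  then show ?thesis
    unfolding cross_rotate_iff(1)[of t h] unfolding cross_def using assms by auto
qed

text \<open>The crossing with all colors reversed and the cyclic order reversed. In an R2 move the
  second crossing is such a mirror image of the first.\<close>

lemma cross_reverse:
  assumes "cross t a b c d"
  shows "cross t (opp a) (opp d) (opp c) (opp b)"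
proof -
  have X: "a \<in> X" "b \<in> X" "opp b \<in> X" "d \<in> X" and c: "c = opp (act t a (opp b))" and d: "d = act (\<not> t) (opp b) a"
    using assms by (auto simp: cross_def)
  have "act t a (opp b) = opp (act t (opp a) d)"
    unfolding d opp_act[OF X(1,3), symmetric] using X by simp
  moreover have "opp b = act (\<not> t) d (opp a)"
    unfolding d by (rule act_opp[OF X(1,3), symmetric])
  ultimately show ?thesis using X c by (simp add: cross_def)
qed

section \<open>Colors around the triangle of R3\<close>

context
  fixes AB BC AC :: bool
  assumes heights: "\<not> (AB = BC \<and> AC \<noteq> AB)"
begin

text \<open>One equation per strand: its final color does not depend on the order in which it passes
  the other two. The side condition on heights carries over to each of the three
  permutations.\<close>

lemma triangle_exchange:
  assumes "U \<in> X" "V \<in> X" "W \<in> X"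
  shows "act AC (act AB U V) (act (\<not> BC) W V) = act AB (act AC U W) (act BC V W)"
    "act BC (act (\<not> AB) V U) (act (\<not> AC) W U) = act (\<not> AB) (act BC V W) (act AC U W)"
    "act (\<not> BC) (act (\<not> AC) W U) (act (\<not> AB) V U) = act (\<not> AC) (act (\<not> BC) W V) (act AB U V)"
proof -
  have 1: "\<not> ((\<not> AB) = AC \<and> BC \<noteq> (\<not> AB))" and 2: "\<not> ((\<not> AC) = AB \<and> (\<not> BC) \<noteq> (\<not> AC))"
    using heights by blast+
  show "act AC (act AB U V) (act (\<not> BC) W V) = act AB (act AC U W) (act BC V W)"
    by (rule act_exchange[OF assms(1,2,3) heights])
  show "act BC (act (\<not> AB) V U) (act (\<not> AC) W U) = act (\<not> AB) (act BC V W) (act AC U W)"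
    by (rule act_exchange[OF assms(2,1,3) 1])
  show "act (\<not> BC) (act (\<not> AC) W U) (act (\<not> AB) V U) = act (\<not> AC) (act (\<not> BC) W V) (act AB U V)"
    by (rule act_exchange[OF assms(3,1,2) 2])
qed

text \<open>Every coloring of either side of R3 arises in this way from the colors \<open>U\<close>, \<open>V\<close>, \<open>W\<close> of three
  pieces around a face.\<close>

lemma triangle_first:
  assumes "U \<in> X" "V \<in> X" "W \<in> X"
  shows "cross AB a1 V (opp U) y \<and> cross AC U (opp W) a2 z \<and> cross BC (opp y) (opp z) b2 c2 \<longleftrightarrow>
    y = opp (act (\<not> AB) V U) \<and> z = act (\<not> AC) W U \<and> a1 = act AB U V \<and> a2 = opp (act AC U W) \<and>
    b2 = opp (act BC (act (\<not> AB) V U) (act (\<not> AC) W U)) \<and>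
    c2 = act (\<not> BC) (act (\<not> AC) W U) (act (\<not> AB) V U)"
  unfolding cross_rotate_iff(1)[of AB a1] unfolding cross_def using assms by auto

text \<open>The boundary colors from \<open>triangle_first\<close> are already inserted for the
  strand of \<open>U\<close>. The color \<open>x\<close> is then forced twice, at the
  \<open>AB\<close> crossing and at the \<open>AC\<close> crossing, and the first exchange equation
  says that the two values agree.\<close>

lemma triangle_second:
  assumes "U \<in> X" "V \<in> X" "W \<in> X" "x \<in> X" "y \<in> X" "z \<in> X"
  shows "cross AB (opp x) y (opp (act AC U W)) b2 \<and> cross AC (act AB U V) z x c2 \<and>
      cross BC V (opp W) (opp y) (opp z) \<longleftrightarrow>
    y = act BC V W \<and> z = opp (act (\<not> BC) W V) \<and> x = opp (act AC (act AB U V) (act (\<not> BC) W V)) \<and>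
    b2 = opp (act (\<not> AB) (act BC V W) (act AC U W)) \<and>
    c2 = act (\<not> AC) (act (\<not> BC) W V) (act AB U V)"
proof -
  let ?A = "act AC U W" and ?a1 = "act AB U V" and ?z = "act (\<not> BC) W V"
  have 1: "cross AB (opp x) y (opp ?A) b2 \<longleftrightarrow> b2 = opp (act (\<not> AB) y ?A) \<and> opp x = act AB ?A y"
    unfolding cross_rotate_iff(1)[of AB "opp x"] unfolding cross_def using assms by simp
  have 2: "cross AC ?a1 z x c2 \<longleftrightarrow> x = opp (act AC ?a1 (opp z)) \<and> c2 = act (\<not> AC) (opp z) ?a1"
    unfolding cross_def using assms by simp
  have 3: "cross BC V (opp W) (opp y) (opp z) \<longleftrightarrow> y = act BC V W \<and> opp z = ?z"
    unfolding cross_def using assms by (simp add: opp_inj)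
  have 4: "opp z = ?z \<longleftrightarrow> z = opp ?z"
    using opp_inj[of "opp z" ?z] assms by simp
  have 5: "opp x = act AC ?a1 ?z" if "x = opp (act AC ?a1 ?z)"
    unfolding that using assms by simp
  show ?thesis
    unfolding 1 2 3 using 4 5 triangle_exchange(1)[OF assms(1-3)] by metis
qed

lemma triangle_move:
  assumes "cross AB a1 b1 x y" "cross AC (opp x) c1 a2 z" "cross BC (opp y) (opp z) b2 c2"
  shows "\<exists>x'\<in>X. \<exists>y'\<in>X. \<exists>z'\<in>X. cross AB (opp x') y' a2 b2 \<and> cross AC a1 z' x' c2 \<and>
    cross BC b1 c1 (opp y') (opp z')"
proof -
  define U V W where "U = opp x" "V = b1" "W = opp c1"
  have UVW: "U \<in> X" "V \<in> X" "W \<in> X" "x = opp U" "c1 = opp W"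
    using assms[THEN cross_in] by (auto simp: U_V_W_def)
  have crs: "cross AB a1 V (opp U) y \<and> cross AC U (opp W) a2 z \<and> cross BC (opp y) (opp z) b2 c2"
    using assms unfolding UVW(4,5) U_V_W_def(2) opp_opp[OF UVW(1)] by blast
  have *: "a1 = act AB U V" "a2 = opp (act AC U W)"
    "b2 = opp (act (\<not> AB) (act BC V W) (act AC U W))" "c2 = act (\<not> AC) (act (\<not> BC) W V) (act AB U V)"
    using crs[unfolded triangle_first[OF UVW(1-3)] triangle_exchange(2,3)[OF UVW(1-3)]] by blast+
  show ?thesis
    unfolding UVW(5) U_V_W_def(2)[symmetric] unfolding *
    by (rule bexI[of _ "opp (act AC (act AB U V) (act (\<not> BC) W V))"], rule bexI[of _ "act BC V W"],
        rule bexI[of _ "opp (act (\<not> BC) W V)"], subst triangle_second[OF UVW(1-3)])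
       (use UVW(1-3) in simp_all)
qed

text \<open>Here \<open>U\<close> is the color of a piece that exists only on the other side, so it
  is recovered by undoing the passage of \<open>V\<close> that led to \<open>a1\<close>. That it
  also leads to \<open>a2\<close> follows by computing \<open>x'\<close> at both of its crossings
  and cancelling the action of \<open>y'\<close>.\<close>

lemma triangle_move_back:
  assumes "cross AB (opp x') y' a2 b2" "cross AC a1 z' x' c2" "cross BC b1 c1 (opp y') (opp z')" "z' \<in> X"
  shows "\<exists>x\<in>X. \<exists>y\<in>X. \<exists>z\<in>X. cross AB a1 b1 x y \<and> cross AC (opp x) c1 a2 z \<and>
    cross BC (opp y) (opp z) b2 c2"
proof -
  define V W where "V = b1" "W = opp c1"
  have X: "a1 \<in> X" "b1 \<in> X" "a2 \<in> X" "c1 \<in> X" "y' \<in> X" "x' \<in> X" "opp y' \<in> X"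
    using assms(1-3)[THEN cross_in] by auto
  obtain U where U: "U \<in> X" "act AB U V = a1" by (rule act_surj[OF X(2,1), folded V_W_def])
  have UVW: "U \<in> X" "V \<in> X" "W \<in> X" "c1 = opp W" using X U by (auto simp: V_W_def)
  have y: "y' = act BC V W"
    using assms(3) opp_inj[of y' "act BC V W"] X(5) UVW(2,3) unfolding cross_def V_W_def by simp
  have z: "opp z' = act (\<not> BC) W V"
    using assms(3) by (simp add: cross_def V_W_def)
  have "act AB (opp a2) y' = opp x'"
    using assms(1) unfolding cross_rotate_iff(1)[of AB "opp x'"] unfolding cross_def by simp
  also have "\<dots> = act AC (act AB U V) (act (\<not> BC) W V)"
    using assms(2) X(1) assms(4) unfolding cross_def U(2) z[symmetric] by simp
  also have "\<dots> = act AB (act AC U W) y'"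
    unfolding y by (rule triangle_exchange(1)[OF UVW(1-3)])
  finally have "opp a2 = act AC U W"
    by (rule act_inj[OF X(5) opp_in[OF X(3)] act_in[OF UVW(1,3)], THEN iffD1])
  then have a2: "opp (act AC U W) = a2" using opp_opp[OF X(3)] by (simp only:)
  have "cross AB (opp x') y' (opp (act AC U W)) b2 \<and> cross AC (act AB U V) z' x' c2 \<and>
      cross BC V (opp W) (opp y') (opp z')"
    unfolding a2 U(2) UVW(4)[symmetric] unfolding V_W_def(1) using assms(1-3) by blast
  from this[unfolded triangle_second[OF UVW(1-3) X(6,5) assms(4)]]
  have bc: "b2 = opp (act BC (act (\<not> AB) V U) (act (\<not> AC) W U))"
    "c2 = act (\<not> BC) (act (\<not> AC) W U) (act (\<not> AB) V U)"
    unfolding triangle_exchange[OF UVW(1-3)] by blast+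
  have *: "cross AB a1 V (opp U) (opp (act (\<not> AB) V U)) \<and> cross AC U (opp W) a2 (act (\<not> AC) W U) \<and>
      cross BC (opp (opp (act (\<not> AB) V U))) (opp (act (\<not> AC) W U)) b2 c2"
    unfolding triangle_first[OF UVW(1-3)] U(2) a2 bc[symmetric] using UVW(1-3) by simp
  show ?thesis
    unfolding UVW(4) V_W_def(1)[symmetric]
    by (rule bexI[of _ "opp U"], rule bexI[of _ "opp (act (\<not> AB) V U)"],
        rule bexI[of _ "act (\<not> AC) W U"]) (use * UVW(1-3) in simp_all)
qed

end

section \<open>Colors at a vertex for R4, R5 and R6\<close>

lemma vert_in: "vert a b c \<Longrightarrow> a \<in> X \<and> b \<in> X \<and> c \<in> X"
proof -
  have *: "a \<in> X" if "vert a b c" for a b c using that same_in(1) by (auto simp: vert_def)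
  show "a \<in> X \<and> b \<in> X \<and> c \<in> X" if v: "vert a b c"
    using *[OF v] *[OF vert_rotate[OF v]] *[OF vert_rotate[OF vert_rotate[OF v]]] by blast
qed

lemma vert_determ:
  assumes "vert a b c" "vert a b c'"
  shows "c = c'"
proof -
  obtain h where h: "same a h" "b = act True h a" "c = opp (a \<odot> h)"
    using assms(1) by (auto simp: vert_def)
  obtain h' where h': "same a h'" "b = act True h' a" "c' = opp (a \<odot> h')"
    using assms(2) by (auto simp: vert_def)
  have "h = h'"
    using act_inj[OF same_in(1)[OF h(1)] same_in(2)[OF h(1)] same_in(2)[OF h'(1)], of True] h(2) h'(2)
    by simp
  with h h' show ?thesis by simp
qed

text \<open>Two ways to reorder a product: \<open>a \<odot> h\<close> is also
  \<open>(a \<odot> h \<odot> iv a) \<odot> a\<close> and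
  \<open>h \<odot> (iv h \<odot> a \<odot> h)\<close>. The crossing type selects one of them, and
  the conjugation axiom matches the conjugated factor with the color at the crossing.\<close>

lemma vert_twist:
  assumes "vert a b c"
  shows "\<exists>y\<in>X. vert y (act t a y) c \<and> b = act (\<not> t) y a"
proof -
  obtain h where h: "same a h" "b = act True h a" "c = opp (a \<odot> h)"
    using assms by (auto simp: vert_def)
  have ha: "same h a" and X: "a \<in> X" "h \<in> X" using h(1) same_sym same_in by blast+
  show ?thesis
  proof (cases t)
    case True
    let ?y = "(a \<odot> h) \<odot> iv a"
    have s: "same a ?y"
      using h(1) X by (intro same_mul[OF same_mul] same_iv same_refl)
    have y: "?y \<odot> a = a \<odot> h" using mul_iv_cancel(4)[OF same_mul[OF same_refl[OF X(1)] h(1)]] .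
    have "vert ?y (act t a ?y) c"
      unfolding vert_def h(3)
      by (rule exI[of _ ?y], rule exI[of _ a]) (use same_sym[OF s] y True in simp)
    moreover have "b = act (\<not> t) ?y a" using act_conj_right[OF h(1)] h(2) True by simp
    ultimately show ?thesis using same_in(2)[OF s] by blast
  next
    case False
    let ?k = "iv h \<odot> (a \<odot> h)"
    have s: "same h (a \<odot> h)" by (rule same_mul[OF ha same_refl[OF X(2)]])
    have k: "same h ?k" by (rule same_mul[OF same_iv[OF same_refl[OF X(2)]] s])
    have "vert h (act t a h) c"
      unfolding vert_def h(3)
      by (rule exI[of _ h], rule exI[of _ ?k]) (use k act_conj_left[OF ha] mul_iv_cancel(1)[OF s] False in simp)
    then show ?thesis using h(2) X False by auto
  qed
qed

text \<open>A twist with the opposite crossing type undoes the first one: the color it supplies must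
  be \<open>a\<close>, since both have the same result after passing \<open>y\<close>.\<close>

lemma vert_twist_back:
  assumes "vert y (act t a y) c" "a \<in> X"
  shows "vert a (act (\<not> t) y a) c"
proof -
  have y: "y \<in> X" using assms(1) vert_in by blast
  obtain z where z: "z \<in> X" "vert z (act (\<not> t) y z) c" "act t a y = act (\<not> \<not> t) z y"
    using vert_twist[OF assms(1), of "\<not> t"] by blast
  have "a = z" using z(3) act_inj[OF y assms(2) z(1), of t] by simp
  with z show ?thesis by simp
qed

text \<open>Passing the first two edges amounts to acting by \<open>a \<odot> h\<close>; the third
  edge has color \<open>opp (a \<odot> h)\<close> and cancels this. The edges again form a vertex
  because acting by \<open>k\<close> is a homomorphism, the exchange law adjusting the transported
  second color.\<close>

lemma vert_act:
  assumes "vert a b c" "k \<in> X"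
  shows "act (\<not> t) (act (\<not> t) (act (\<not> t) k a) b) c = k"
    "vert (act t a k) (act t b (act (\<not> t) k a)) (act t c (act (\<not> t) (act (\<not> t) k a) b))"
proof -
  obtain h where h: "same a h" "b = act True h a" "c = opp (a \<odot> h)"
    using assms by (auto simp: vert_def)
  have X: "a \<in> X" "h \<in> X" by (rule same_in[OF h(1)])+
  have p: "a \<odot> h \<in> X" using same_in(2)[OF same_mul[OF same_refl[OF X(1)] h(1)]] .
  have k2: "act (\<not> t) (act (\<not> t) k a) b = act (\<not> t) k (a \<odot> h)"
    unfolding h(2) by (rule act_mul[OF h(1) assms(2), symmetric])
  show "act (\<not> t) (act (\<not> t) (act (\<not> t) k a) b) c = k"
    unfolding k2 h(3) by (rule act_opp[OF p assms(2)])
  have "act t b (act (\<not> t) k a) = act True (act t h k) (act t a k)"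
    unfolding h(2) by (rule act_exchange[OF X(2,1) assms(2)]) simp
  moreover have "act t c (act (\<not> t) (act (\<not> t) k a) b) = opp (act t a k \<odot> act t h k)"
    unfolding k2 h(3) opp_act[OF p assms(2), symmetric] act_hom(2)[OF h(1) assms(2)] ..
  ultimately show "vert (act t a k) (act t b (act (\<not> t) k a)) (act t c (act (\<not> t) (act (\<not> t) k a) b))"
    unfolding vert_def using act_hom(1)[OF h(1) assms(2)] by blast
qed

text \<open>The second factor is pulled back through the action of \<open>k\<close>; it defines a
  vertex whose first color is \<open>a\<close>. Pushing that vertex forward and comparing identifies
  \<open>b\<close> and then \<open>c\<close>, by injectivity.\<close>

lemma vert_act_back:
  assumes "vert (act t a k) (act t b (act (\<not> t) k a)) (act t c (act (\<not> t) (act (\<not> t) k a) b))"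
    and X: "a \<in> X" "b \<in> X" "c \<in> X" "k \<in> X"
  shows "vert a b c"
proof -
  obtain h' where h': "same (act t a k) h'" "act t b (act (\<not> t) k a) = act True h' (act t a k)"
    using assms(1) unfolding vert_def by blast
  obtain h where h: "same a h" "h' = act t h k" by (rule act_mul_reflect[OF X(1,4) h'(1)])
  let ?b = "act True h a" and ?c = "opp (a \<odot> h)"
  have v: "vert a ?b ?c" using h(1) by (auto simp: vert_def)
  have bc: "?b \<in> X" "?c \<in> X" using vert_in[OF v] by blast+
  have "act t ?b (act (\<not> t) k a) = act True (act t h k) (act t a k)"
    by (rule act_exchange[OF same_in(2)[OF h(1)] X(1,4)]) simp
  then have b: "b = ?b" using h' h act_inj[of "act (\<not> t) k a" b ?b t] X bc by simp
  have "act t c (act (\<not> t) (act (\<not> t) k a) b) = act t ?c (act (\<not> t) (act (\<not> t) k a) b)"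
    using vert_determ[OF assms(1)] vert_act(2)[OF v X(4), of t] unfolding b[symmetric] by blast
  then have "c = ?c" using act_inj[of "act (\<not> t) (act (\<not> t) k a) b" c ?c t] X bc by simp
  with v b show ?thesis by simp
qed

text \<open>The two bracketings of \<open>p \<odot> h \<odot> f\<close>. The new edge carries
  \<open>h \<odot> f\<close> transported by \<open>p\<close>, and the product law shows that
  \<open>r\<close> is the factor \<open>f\<close> transported by \<open>p\<close> and then by
  \<open>s\<close>.\<close>

lemma vert_assoc:
  assumes "vert p s x" "vert (opp x) r q"
  shows "\<exists>y\<in>X. vert p y q \<and> vert (opp y) s r"
proof -
  obtain h where h: "same p h" "s = act True h p" "x = opp (p \<odot> h)"
    using assms by (auto simp: vert_def)
  have p: "p \<in> X" by (rule same_in(1)[OF h(1)])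
  have ph: "same p (p \<odot> h)" by (rule same_mul[OF same_refl[OF p] h(1)])
  have x: "opp x = p \<odot> h" using same_in(2)[OF ph] h(3) by simp
  obtain f where f: "same (p \<odot> h) f" "r = act True f (p \<odot> h)" "q = opp (p \<odot> h \<odot> f)"
    using assms(2) unfolding x by (auto simp: vert_def)
  have pf: "same p f" by (rule same_trans[OF ph f(1)])
  have hf: "same h f" by (rule same_trans[OF same_sym[OF h(1)] pf])
  let ?y = "act True (h \<odot> f) p"
  have phf: "same p (h \<odot> f)" by (rule same_mul[OF h(1) pf])
  have "vert p ?y q"
    unfolding vert_def using phf f(3) mul_assoc[OF h(1) pf] by auto
  moreover have "vert s r (opp ?y)"
    unfolding vert_def act_hom(2)[OF hf p] f(2) h(2) act_mul[OF h(1) same_in(2)[OF pf]]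
    using act_hom(1)[OF hf p] by blast
  ultimately show ?thesis
    using vert_rotate_iff(2)[of s r "opp ?y"] same_in(2)[OF phf] p by (intro bexI[of _ ?y]) simp_all
qed

section \<open>The moves on the level of diagrams\<close>

lemma inw_put_if:
  "v \<in> X \<Longrightarrow> inw (put h v c) k = (if k = h then v else if k = flip h then opp v else inw c k)"
  using inw_put[of v h c] inw_put_other[of k h v c] by (auto simp: piece_eq_iff)

lemma put_same: "k \<noteq> h \<Longrightarrow> k \<noteq> flip h \<Longrightarrow> put h v c (piece k) = c (piece k)"
  using put_other[of k h v c] by (simp add: piece_eq_iff)

lemma put_in_iff:
  "v \<in> X \<Longrightarrow> put h v c (piece k) \<in> X \<longleftrightarrow> k = h \<or> k = flip h \<or> c (piece k) \<in> X"
  using put_in[of v h c] put_same[of k h v c] by (cases "k = h \<or> k = flip h") auto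

lemma inw_cong: "c (piece h) = c' (piece h) \<Longrightarrow> inw c h = inw c' h"
  by (cases h) simp_all

lemmas put_simps = inw_put_if put_in_iff put_same

definition extends :: "'e piece_end set \<Rightarrow> 'e node multiset \<Rightarrow> 'e node multiset \<Rightarrow> bool"
  where "extends B P P' \<longleftrightarrow> (\<forall>c. (\<forall>n\<in>#P. sat c n) \<longrightarrow>
    (\<exists>c'. (\<forall>h\<in>B. c' (piece h) = c (piece h)) \<and> (\<forall>n\<in>#P'. sat c' n)))"

definition rigid :: "'e piece_end set \<Rightarrow> 'e node multiset \<Rightarrow> bool"
  where "rigid B P \<longleftrightarrow> (\<forall>c c'. (\<forall>n\<in>#P. sat c n) \<longrightarrow> (\<forall>n\<in>#P. sat c' n) \<longrightarrow>
    (\<forall>h\<in>B. c (piece h) = c' (piece h)) \<longrightarrow> (\<forall>e\<in>pieces P. c e = c' e))"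

text \<open>Symmetric in \<open>P\<close> and \<open>P'\<close>, so that a move and its inverse are
  settled together.\<close>

definition equivalent :: "'e piece_end set \<Rightarrow> 'e node multiset \<Rightarrow> 'e node multiset \<Rightarrow> bool"
  where "equivalent B P P' \<longleftrightarrow> extends B P P' \<and> extends B P' P \<and> rigid B P \<and> rigid B P'"

text \<open>For uniqueness each interior piece may be compared at whichever of its ends the color is
  forced, since its two inward colors determine each other.\<close>

lemma equivalentI:
  assumes "\<And>c. \<forall>n\<in>#P. sat c n \<Longrightarrow>
      \<exists>c'. (\<forall>h\<in>B. c' (piece h) = c (piece h)) \<and> (\<forall>n\<in>#P'. sat c' n)"
    and "\<And>c. \<forall>n\<in>#P'. sat c n \<Longrightarrow>
      \<exists>c'. (\<forall>h\<in>B. c' (piece h) = c (piece h)) \<and> (\<forall>n\<in>#P. sat c' n)"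
    and "\<And>c c'. \<lbrakk>\<forall>n\<in>#P. sat c n; \<forall>n\<in>#P. sat c' n; \<forall>h\<in>B. inw c h = inw c' h\<rbrakk> \<Longrightarrow>
      \<forall>h\<in>ends_of P. h \<in> B \<or> inw c h = inw c' h \<or> inw c (flip h) = inw c' (flip h)"
    and "\<And>c c'. \<lbrakk>\<forall>n\<in>#P'. sat c n; \<forall>n\<in>#P'. sat c' n; \<forall>h\<in>B. inw c h = inw c' h\<rbrakk> \<Longrightarrow>
      \<forall>h\<in>ends_of P'. h \<in> B \<or> inw c h = inw c' h \<or> inw c (flip h) = inw c' (flip h)"
  shows "equivalent B P P'"
proof -
  have *: "rigid B Q"
    if r: "\<And>c c'. \<lbrakk>\<forall>n\<in>#Q. sat c n; \<forall>n\<in>#Q. sat c' n; \<forall>h\<in>B. inw c h = inw c' h\<rbrakk> \<Longrightarrow>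
      \<forall>h\<in>ends_of Q. h \<in> B \<or> inw c h = inw c' h \<or> inw c (flip h) = inw c' (flip h)" for Q
    unfolding rigid_def pieces_def
  proof (intro allI impI ballI)
    fix c c' e
    assume s: "\<forall>n\<in>#Q. sat c n" "\<forall>n\<in>#Q. sat c' n" and b: "\<forall>h\<in>B. c (piece h) = c' (piece h)"
      and "e \<in> piece ` ends_of Q"
    then obtain h where h: "e = piece h" "h \<in> ends_of Q" by blast
    have X: "c (piece h) \<in> X" "c' (piece h) \<in> X"
      using s h(2) by (auto simp: sat_def ends_of_def)
    have "\<forall>h\<in>B. inw c h = inw c' h" using b by (auto intro: inw_cong)
    from bspec[OF r[OF s this] h(2)]
    consider "h \<in> B" | "inw c h = inw c' h" | "inw c (flip h) = inw c' (flip h)"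
      by (elim disjE)
    then show "c e = c' e"
    proof cases
      case 1
      then show ?thesis using b h(1) by simp
    next
      case 2
      then show ?thesis using inw_inj[of c h c', OF X] h(1) by simp
    next
      case 3
      then show ?thesis using inw_inj[of c "flip h" c'] X h(1) by simp
    qed
  qed
  show ?thesis
    unfolding equivalent_def extends_def
  proof (intro conjI allI impI)
    show "rigid B P" by (rule *) (rule assms(3))
    show "rigid B P'" by (rule *) (rule assms(4))
  qed (rule assms(1,2), assumption)+
qed

lemma ends_of_add_mset: "ends_of (add_mset n D) = set (ends n) \<union> ends_of D" "ends_of {#} = {}"
  by (simp_all add: ends_of_def)

text \<open>The part of \<open>diagram\<close> that passes to the nodes inside the disk.\<close>

definition simple :: "'e node multiset \<Rightarrow> bool"
  where "simple D \<longleftrightarrow> (\<forall>h. count (\<Sum>n\<in>#D. mset (ends n)) h \<le> 1)"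

lemma distinct_of_count: "\<forall>h. count (mset xs) h \<le> 1 \<Longrightarrow> distinct xs"
proof (induction xs)
  case (Cons x xs)
  have 1: "count (mset xs) h \<le> 1" for h
  proof -
    have "count (mset xs) h \<le> count (mset (x # xs)) h" by simp
    also have "\<dots> \<le> 1" using Cons.prems by blast
    finally show ?thesis .
  qed
  have "count (mset xs) x = 0"
    using Cons.prems[rule_format, of x] by simp
  then have "x \<notin> set xs" by (simp add: count_eq_zero_iff)
  then show ?case using Cons.IH 1 by simp
qed simp

lemma simple_distinct:
  "simple {#n1#} \<Longrightarrow> view n1 hs1 \<Longrightarrow> distinct hs1"
  "simple {#n1, n2#} \<Longrightarrow> view n1 hs1 \<Longrightarrow> view n2 hs2 \<Longrightarrow> distinct (hs1 @ hs2)"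
  "simple {#n1, n2, n3#} \<Longrightarrow> view n1 hs1 \<Longrightarrow> view n2 hs2 \<Longrightarrow> view n3 hs3 \<Longrightarrow>
    distinct (hs1 @ hs2 @ hs3)"
  "simple {#n1, n2, n3, n4#} \<Longrightarrow> view n1 hs1 \<Longrightarrow> view n2 hs2 \<Longrightarrow> view n3 hs3 \<Longrightarrow> view n4 hs4 \<Longrightarrow>
    distinct (hs1 @ hs2 @ hs3 @ hs4)"
  unfolding simple_def by (rule distinct_of_count, simp add: view_mset[of n1 hs1] view_mset[of n2 hs2] view_mset[of n3 hs3] view_mset[of n4 hs4])+

section \<open>Local equivalence for each of the six moves\<close>

lemma equivalent_R1:
  assumes v: "view m [h, k]" "view c [h, flip l, l, k]" and s: "simple {#c#}"
  shows "equivalent {h, k} {#m#} {#c#}"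
proof (rule equivalentI)
  have d: "distinct [h, flip l, l, k]" by (rule simple_distinct(1)[OF s v(2)])
  \<comment> \<open>The reversed list supplies every inequality between ends in the other
    orientation too, which the simplifier needs to evaluate \<open>put\<close>.\<close>
  have dr: "distinct (rev [h, flip l, l, k])" using d by (simp only: distinct_rev)
  note S = sat_view_mark[OF v(1)] view_crossing(3)[OF v(2) d]
  show "\<exists>g'. (\<forall>e\<in>{h, k}. g' (piece e) = g (piece e)) \<and> (\<forall>n\<in>#{#c#}. sat g' n)"
    if "\<forall>n\<in>#{#m#}. sat g n" for g
  proof -
    have g: "g (piece h) \<in> X" "g (piece k) \<in> X" "inw g k = opp (inw g h)" using that by (simp_all add: S)
    \<comment> \<open>The loop crosses itself, so its color must be a square root of the strand
      color for the diagonal map.\<close>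
    obtain q where q: "q \<in> X" "act True q q = inw g h" by (rule act_diag_surj[OF inw_in[of g h, OF g(1)]])
    have "cross (over c h) (inw g h) q (opp q) (inw g k)"
      using cross_loop[of "opp q" "over c h" "inw g h" "inw g k"] q g(3) by simp
    then show ?thesis
      using g(1,2) q(1) d dr by (intro exI[of _ "put l (opp q) g"]) (simp add: S put_simps)
  qed
  show "\<exists>g'. (\<forall>e\<in>{h, k}. g' (piece e) = g (piece e)) \<and> (\<forall>n\<in>#{#m#}. sat g' n)"
    if "\<forall>n\<in>#{#c#}. sat g n" for g
  proof -
    have g: "g (piece h) \<in> X" "g (piece k) \<in> X" "g (piece l) \<in> X"
        "cross (over c h) (inw g h) (opp (inw g l)) (inw g l) (inw g k)"
      using that by (simp_all add: S inw_flip cong: conj_cong)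
    have "inw g k = opp (inw g h)"
      using g(4) cross_loop[OF inw_in[of g l, OF g(3)]] by blast
    then show ?thesis
      using g(1,2) by (intro exI[of _ g]) (simp add: S)
  qed
  show "\<forall>e\<in>ends_of {#m#}. e \<in> {h, k} \<or> inw g e = inw g' e \<or> inw g (flip e) = inw g' (flip e)" for g g'
    by (simp add: ends_of_add_mset view_set[OF v(1)])
  show "\<forall>e\<in>ends_of {#c#}. e \<in> {h, k} \<or> inw g e = inw g' e \<or> inw g (flip e) = inw g' (flip e)"
    if "\<forall>n\<in>#{#c#}. sat g n" "\<forall>n\<in>#{#c#}. sat g' n" "\<forall>e\<in>{h, k}. inw g e = inw g' e" for g g'
  proof -
    have l: "g (piece l) \<in> X" "g' (piece l) \<in> X"
      "cross (over c h) (inw g h) (opp (inw g l)) (inw g l) (inw g k)"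
      "cross (over c h) (inw g' h) (opp (inw g' l)) (inw g' l) (inw g' k)"
      using that(1,2) by (simp_all add: S inw_flip cong: conj_cong)
    have hh: "inw g h = inw g' h" using that(3) by simp
    have "act True (inw g (flip l)) (inw g (flip l)) = act True (inw g' (flip l)) (inw g' (flip l))"
      unfolding inw_flip[of g l, OF l(1)] inw_flip[of g' l, OF l(2)]
      using cross_loop[OF inw_in[of g l, OF l(1)]] cross_loop[OF inw_in[of g' l, OF l(2)]] l(3,4) hh
      by metis
    then have "inw g (flip l) = inw g' (flip l)"
      by (rule act_diag_inj[rotated 2]) (simp_all add: inw_in l(1,2))
    then show ?thesis by (simp add: ends_of_add_mset view_set[OF v(2)])
  qed
qed

lemma equivalent_R2:
  assumes v: "view m [h1, h2]" "view n [k1, k2]" "view c [h1, y, x, k1]" "view d [flip y, h2, k2, flip x]"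
    and o: "over c h1 \<longleftrightarrow> over d h2" and s: "simple {#c, d#}"
  shows "equivalent {h1, h2, k1, k2} {#m, n#} {#c, d#}"
proof (rule equivalentI)
  have d: "distinct ([h1, y, x, k1] @ [flip y, h2, k2, flip x])" by (rule simple_distinct(2)[OF s v(3,4)])
  then have dr: "distinct (rev ([h1, y, x, k1] @ [flip y, h2, k2, flip x]))" by (simp only: distinct_rev)
  from d have d1: "distinct [h1, y, x, k1]" and d2: "distinct [flip y, h2, k2, flip x]" by simp_all
  have o2: "over d (flip y) \<longleftrightarrow> \<not> over c h1" using view_crossing(1)[OF v(4) d2] o by simp
  note S = sat_view_mark[OF v(1)] sat_view_mark[OF v(2)] view_crossing(3)[OF v(3) d1]
    view_crossing(3)[OF v(4) d2, unfolded o2]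
  \<comment> \<open>The lower crossing, read from \<open>flip y\<close>, is the upper one mirrored
    and turned by a quarter.\<close>
  have bigon: "cross (\<not> t) (opp b) (opp a) (opp e) (opp c) \<longleftrightarrow> cross t a b c e"
    if "a \<in> X" "b \<in> X" "c \<in> X" "e \<in> X" for t a b c e
  proof -
    have "cross t (opp a) (opp e) (opp c) (opp b) \<longleftrightarrow> cross t a b c e"
      using cross_reverse[of t a b c e] cross_reverse[of t "opp a" "opp e" "opp c" "opp b"] that by auto
    then show ?thesis using cross_rotate_iff(1)[of "\<not> t" "opp b" "opp a" "opp e" "opp c"] by simp
  qed
  show "\<exists>g'. (\<forall>e\<in>{h1, h2, k1, k2}. g' (piece e) = g (piece e)) \<and> (\<forall>n\<in>#{#c, d#}. sat g' n)"
    if "\<forall>n\<in>#{#m, n#}. sat g n" for g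
  proof -
    have g: "g (piece h1) \<in> X" "g (piece h2) \<in> X" "g (piece k1) \<in> X" "g (piece k2) \<in> X"
      "inw g h2 = opp (inw g h1)" "inw g k2 = opp (inw g k1)"
      using that by (simp_all add: S)
    obtain a b where ab: "a \<in> X" "b \<in> X" "cross (\<not> over c h1) (inw g k1) (inw g h1) a b"
      using cross_exists[OF inw_in[of g k1, OF g(3)] inw_in[of g h1, OF g(1)]] by blast
    have 1: "cross (over c h1) (inw g h1) a b (inw g k1)"
      using ab(3) cross_rotate_iff(3) by blast
    moreover have "cross (\<not> over c h1) (opp a) (inw g h2) (inw g k2) (opp b)"
      using 1 bigon[OF inw_in[of g h1, OF g(1)] ab(1,2) inw_in[of g k1, OF g(3)]] unfolding g(5,6) by blast
    ultimately show ?thesis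
      using g(1-4) ab(1,2) d dr by (intro exI[of _ "put x b (put y a g)"]) (simp add: S put_simps)
  qed
  show "\<exists>g'. (\<forall>e\<in>{h1, h2, k1, k2}. g' (piece e) = g (piece e)) \<and> (\<forall>n\<in>#{#m, n#}. sat g' n)"
    if "\<forall>n\<in>#{#c, d#}. sat g n" for g
  proof -
    have X: "inw g h1 \<in> X" "inw g h2 \<in> X" "inw g k1 \<in> X" "inw g k2 \<in> X" "inw g x \<in> X" "inw g y \<in> X"
      and g: "g (piece h1) \<in> X" "g (piece h2) \<in> X" "g (piece k1) \<in> X" "g (piece k2) \<in> X"
      and c: "cross (over c h1) (inw g h1) (inw g y) (inw g x) (inw g k1)"
        "cross (\<not> over c h1) (opp (inw g y)) (inw g h2) (inw g k2) (opp (inw g x))"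
      using that by (simp_all add: S inw_flip inw_in cong: conj_cong)
    \<comment> \<open>Both crossings are now conditions of the same type with the same bigon colors
      \<open>y\<close>, \<open>x\<close>, and these determine the two outer colors.\<close>
    have "cross (over c h1) (opp (inw g h2)) (inw g y) (inw g x) (opp (inw g k2))"
      using c(2) bigon[of "opp (inw g h2)" "inw g y" "inw g x" "opp (inw g k2)" "over c h1"] X by simp
    then have "inw g k1 = opp (inw g k2) \<and> inw g h1 = opp (inw g h2)"
      using c(1) cross_determ[of _ "inw g y" "inw g x"] cross_rotate_iff(1)[of "over c h1"]
      by blast
    then have "inw g k2 = opp (inw g k1) \<and> inw g h2 = opp (inw g h1)" using X by simp
    then show ?thesis
      using g by (intro exI[of _ g]) (simp add: S)
  qed
  show "\<forall>e\<in>ends_of {#m, n#}. e \<in> {h1, h2, k1, k2} \<or> inw g e = inw g' e \<or> inw g (flip e) = inw g' (flip e)" for g g'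
    by (simp add: ends_of_add_mset view_set[OF v(1)] view_set[OF v(2)])
  show "\<forall>e\<in>ends_of {#c, d#}. e \<in> {h1, h2, k1, k2} \<or> inw g e = inw g' e \<or> inw g (flip e) = inw g' (flip e)"
    if "\<forall>n\<in>#{#c, d#}. sat g n" "\<forall>n\<in>#{#c, d#}. sat g' n" "\<forall>e\<in>{h1, h2, k1, k2}. inw g e = inw g' e" for g g'
  proof -
    have "cross (over c h1) (inw g h1) (inw g y) (inw g x) (inw g k1)"
      "cross (over c h1) (inw g h1) (inw g' y) (inw g' x) (inw g k1)"
      using that by (simp_all add: S)
    then have "inw g y = inw g' y \<and> inw g x = inw g' x"
      using cross_rotate_iff(3)[of "over c h1"] cross_determ[of _ "inw g k1" "inw g h1"] by blast
    then show ?thesis by (simp add: ends_of_add_mset view_set[OF v(3)] view_set[OF v(4)])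
  qed
qed

lemma equivalent_R3:
  fixes ha hb hc :: nat
  assumes neq: "ha \<noteq> hb" "hb \<noteq> hc" "ha \<noteq> hc"
    and v: "view ab [a1, b1, x, y]" "view ac [flip x, c1, a2, z]" "view bc [flip y, flip z, b2, c2]"
    and o: "over ab a1 \<longleftrightarrow> hb < ha" "over ac a2 \<longleftrightarrow> hc < ha" "over bc b2 \<longleftrightarrow> hc < hb"
    and v': "view ac' [a1, z', x', c2]" "view ab' [flip x', y', a2, b2]" "view bc' [b1, c1, flip y', flip z']"
    and o': "over ab' a2 \<longleftrightarrow> hb < ha" "over ac' a1 \<longleftrightarrow> hc < ha" "over bc' b1 \<longleftrightarrow> hc < hb"
    and s: "simple {#ab, ac, bc#}" "simple {#ab', ac', bc'#}"
  shows "equivalent {a1, a2, b1, b2, c1, c2} {#ab, ac, bc#} {#ab', ac', bc'#}"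
proof (rule equivalentI)
  have d: "distinct ([a1, b1, x, y] @ [flip x, c1, a2, z] @ [flip y, flip z, b2, c2])"
    by (rule simple_distinct(3)[OF s(1) v])
  then have dr: "distinct (rev ([a1, b1, x, y] @ [flip x, c1, a2, z] @ [flip y, flip z, b2, c2]))"
    by (simp only: distinct_rev)
  have d': "distinct ([flip x', y', a2, b2] @ [a1, z', x', c2] @ [b1, c1, flip y', flip z'])"
    by (rule simple_distinct(3)[OF s(2) v'(2,1,3)])
  then have dr': "distinct (rev ([flip x', y', a2, b2] @ [a1, z', x', c2] @ [b1, c1, flip y', flip z']))"
    by (simp only: distinct_rev)
  have e: "distinct [a1, b1, x, y]" "distinct [flip x, c1, a2, z]" "distinct [flip y, flip z, b2, c2]"
    using d by simp_all
  have e': "distinct [a1, z', x', c2]" "distinct [flip x', y', a2, b2]" "distinct [b1, c1, flip y', flip z']"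
    using d' by simp_all
  define AB AC BC where "AB \<longleftrightarrow> hb < ha" and "AC \<longleftrightarrow> hc < ha" and "BC \<longleftrightarrow> hc < hb"
  \<comment> \<open>Distinct heights order the strands linearly, which rules out the two cyclic
    patterns.\<close>
  have heights: "\<not> (AB = BC \<and> AC \<noteq> AB)"
    using neq unfolding AB_def AC_def BC_def by linarith
  have o1: "over ab a1 = AB" "over ac (flip x) = AC" "over bc (flip y) = BC"
    using o view_crossing(2)[OF v(2) e(2)] view_crossing(2)[OF v(3) e(3)]
    unfolding AB_def AC_def BC_def by simp_all
  have o2: "over ac' a1 = AC" "over ab' (flip x') = AB" "over bc' b1 = BC"
    using o' view_crossing(2)[OF v'(2) e'(2)]
    unfolding AB_def AC_def BC_def by simp_all
  note S = view_crossing(3)[OF v(1) e(1), unfolded o1] view_crossing(3)[OF v(2) e(2), unfolded o1]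
    view_crossing(3)[OF v(3) e(3), unfolded o1]
  note S' = view_crossing(3)[OF v'(1) e'(1), unfolded o2] view_crossing(3)[OF v'(2) e'(2), unfolded o2]
    view_crossing(3)[OF v'(3) e'(3), unfolded o2]
  show "\<exists>g'. (\<forall>e\<in>{a1, a2, b1, b2, c1, c2}. g' (piece e) = g (piece e)) \<and> (\<forall>n\<in>#{#ab', ac', bc'#}. sat g' n)"
    if "\<forall>n\<in>#{#ab, ac, bc#}. sat g n" for g
  proof -
    have g: "g (piece a1) \<in> X" "g (piece a2) \<in> X" "g (piece b1) \<in> X" "g (piece b2) \<in> X"
      "g (piece c1) \<in> X" "g (piece c2) \<in> X"
      and c: "cross AB (inw g a1) (inw g b1) (inw g x) (inw g y)"
      "cross AC (opp (inw g x)) (inw g c1) (inw g a2) (inw g z)"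
      "cross BC (opp (inw g y)) (opp (inw g z)) (inw g b2) (inw g c2)"
      using that by (simp_all add: S inw_flip cong: conj_cong)
    obtain p q r where pqr: "p \<in> X" "q \<in> X" "r \<in> X"
      "cross AB (opp p) q (inw g a2) (inw g b2)" "cross AC (inw g a1) r p (inw g c2)"
      "cross BC (inw g b1) (inw g c1) (opp q) (opp r)"
      using triangle_move[OF heights c] by (elim bexE conjE)
    show ?thesis
      using g pqr d' dr' by (intro exI[of _ "put x' p (put y' q (put z' r g))"]) (simp add: S' put_simps)
  qed
  show "\<exists>g'. (\<forall>e\<in>{a1, a2, b1, b2, c1, c2}. g' (piece e) = g (piece e)) \<and> (\<forall>n\<in>#{#ab, ac, bc#}. sat g' n)"
    if "\<forall>n\<in>#{#ab', ac', bc'#}. sat g n" for g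
  proof -
    have g: "g (piece a1) \<in> X" "g (piece a2) \<in> X" "g (piece b1) \<in> X" "g (piece b2) \<in> X"
      "g (piece c1) \<in> X" "g (piece c2) \<in> X"
      and c: "cross AB (opp (inw g x')) (inw g y') (inw g a2) (inw g b2)"
      "cross AC (inw g a1) (inw g z') (inw g x') (inw g c2)"
      "cross BC (inw g b1) (inw g c1) (opp (inw g y')) (opp (inw g z'))" "inw g z' \<in> X"
      using that by (simp_all add: S' inw_flip inw_in cong: conj_cong)
    obtain p q r where pqr: "p \<in> X" "q \<in> X" "r \<in> X"
      "cross AB (inw g a1) (inw g b1) p q" "cross AC (opp p) (inw g c1) (inw g a2) r"
      "cross BC (opp q) (opp r) (inw g b2) (inw g c2)"
      using triangle_move_back[OF heights c] by (elim bexE conjE)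
    show ?thesis
      using g pqr d dr by (intro exI[of _ "put x p (put y q (put z r g))"]) (simp add: S put_simps)
  qed
  show "\<forall>e\<in>ends_of {#ab, ac, bc#}. e \<in> {a1, a2, b1, b2, c1, c2} \<or> inw g e = inw g' e \<or> inw g (flip e) = inw g' (flip e)"
    if "\<forall>n\<in>#{#ab, ac, bc#}. sat g n" "\<forall>n\<in>#{#ab, ac, bc#}. sat g' n"
      "\<forall>e\<in>{a1, a2, b1, b2, c1, c2}. inw g e = inw g' e" for g g'
  proof -
    have "cross AB (inw g a1) (inw g b1) (inw g x) (inw g y)" "cross AB (inw g a1) (inw g b1) (inw g' x) (inw g' y)"
      using that by (simp_all add: S)
    then have xy: "inw g x = inw g' x \<and> inw g y = inw g' y" by (rule cross_determ)
    have "cross AC (opp (inw g x)) (inw g c1) (inw g a2) (inw g z)"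
      "cross AC (opp (inw g' x)) (inw g c1) (inw g a2) (inw g' z)"
      using that by (simp_all add: S inw_flip cong: conj_cong)
    with xy have "inw g z = inw g' z" using cross_determ by metis
    with xy show ?thesis by (simp add: ends_of_add_mset view_set[OF v(1)] view_set[OF v(2)] view_set[OF v(3)])
  qed
  show "\<forall>e\<in>ends_of {#ab', ac', bc'#}. e \<in> {a1, a2, b1, b2, c1, c2} \<or> inw g e = inw g' e \<or> inw g (flip e) = inw g' (flip e)"
    if "\<forall>n\<in>#{#ab', ac', bc'#}. sat g n" "\<forall>n\<in>#{#ab', ac', bc'#}. sat g' n"
      "\<forall>e\<in>{a1, a2, b1, b2, c1, c2}. inw g e = inw g' e" for g g'
  proof -
    have X: "g (piece z') \<in> X" "g' (piece z') \<in> X" using that by (simp_all add: S')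
    have "cross BC (inw g b1) (inw g c1) (inw g (flip y')) (inw g (flip z'))"
      "cross BC (inw g b1) (inw g c1) (inw g' (flip y')) (inw g' (flip z'))"
      using that by (simp_all add: S')
    then have yz: "inw g (flip y') = inw g' (flip y') \<and> inw g (flip z') = inw g' (flip z')" by (rule cross_determ)
    then have z: "inw g z' = inw g' z'"
      using X by (simp add: inw_flip opp_inj inw_in)
    have "cross AC (inw g a1) (inw g z') (inw g x') (inw g c2)"
      "cross AC (inw g a1) (inw g' z') (inw g' x') (inw g c2)"
      using that by (simp_all add: S')
    with z have "inw g x' = inw g' x'" using cross_determ by metis
    with yz show ?thesis by (simp add: ends_of_add_mset view_set[OF v'(1)] view_set[OF v'(2)] view_set[OF v'(3)])
  qed
qed

lemma equivalent_R4:
  assumes v: "view v [h1, h2, h3]" "view v' [h1, x, y]" "view c [flip x, h2, h3, flip y]"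
    and s: "simple {#v', c#}"
  shows "equivalent {h1, h2, h3} {#v#} {#v', c#}"
proof (rule equivalentI)
  have d: "distinct ([h1, x, y] @ [flip x, h2, h3, flip y])"
    by (rule simple_distinct(2)[OF s v(2,3)])
  then have dr: "distinct (rev ([h1, x, y] @ [flip x, h2, h3, flip y]))" by (simp only: distinct_rev)
  have e: "distinct [flip x, h2, h3, flip y]" using d by simp
  define t where "t = over c (flip x)"
  note S = sat_view_vertex[OF v(1)] sat_view_vertex[OF v(2)] view_crossing(3)[OF v(3) e, folded t_def]
  \<comment> \<open>Reading the crossing from \<open>h3\<close> brings it into the form supplied by
    \<open>vert_twist\<close>.\<close>
  have twist: "cross t (opp p) (inw g h2) (inw g h3) (opp q) \<longleftrightarrow>
      p = act t (inw g h3) q \<and> inw g h2 = act (\<not> t) q (inw g h3)"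
    if "p \<in> X" "q \<in> X" "inw g h3 \<in> X" for p q and g :: "'a \<Rightarrow> 'x"
    using that unfolding cross_rotate_iff(2)[of t "opp p"] unfolding cross_def by (simp add: opp_inj)
  show "\<exists>g'. (\<forall>e\<in>{h1, h2, h3}. g' (piece e) = g (piece e)) \<and> (\<forall>n\<in>#{#v', c#}. sat g' n)"
    if "\<forall>n\<in>#{#v#}. sat g n" for g
  proof -
    have g: "g (piece h1) \<in> X" "g (piece h2) \<in> X" "g (piece h3) \<in> X"
      and c: "vert (inw g h3) (inw g h2) (inw g h1)"
      using that vert_rotate_iff(1)[of "inw g h1"] by (simp_all add: S)
    have X: "inw g h3 \<in> X" by (rule inw_in[of g h3, OF g(3)])
    obtain q where q: "q \<in> X" "vert q (act t (inw g h3) q) (inw g h1)" "inw g h2 = act (\<not> t) q (inw g h3)"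
      using vert_twist[OF c, of t] by (elim bexE conjE)
    let ?p = "act t (inw g h3) q"
    have p: "?p \<in> X" "cross t (opp ?p) (inw g h2) (inw g h3) (opp q)" "vert (inw g h1) q ?p"
      using twist[of ?p q g] q X vert_rotate_iff(1)[of "inw g h1"] by simp_all
    show ?thesis
      using g p q(1) d dr by (intro exI[of _ "put x ?p (put y q g)"]) (simp add: S put_simps)
  qed
  show "\<exists>g'. (\<forall>e\<in>{h1, h2, h3}. g' (piece e) = g (piece e)) \<and> (\<forall>n\<in>#{#v#}. sat g' n)"
    if "\<forall>n\<in>#{#v', c#}. sat g n" for g
  proof -
    have g: "g (piece h1) \<in> X" "g (piece h2) \<in> X" "g (piece h3) \<in> X"
      and X: "inw g h3 \<in> X" "inw g x \<in> X" "inw g y \<in> X"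
      and c: "vert (inw g y) (inw g x) (inw g h1)" "cross t (opp (inw g x)) (inw g h2) (inw g h3) (opp (inw g y))"
      using that vert_rotate_iff(1)[of "inw g h1"] by (simp_all add: S inw_flip inw_in cong: conj_cong)
    have x: "inw g x = act t (inw g h3) (inw g y)" and h2: "inw g h2 = act (\<not> t) (inw g y) (inw g h3)"
      using c(2) twist[OF X(2,3,1)] by simp_all
    have "vert (inw g h3) (inw g h2) (inw g h1)"
      unfolding h2 by (rule vert_twist_back[OF c(1)[unfolded x] X(1)])
    then show ?thesis
      using g vert_rotate_iff(1)[of "inw g h1"] by (intro exI[of _ g]) (simp add: S)
  qed
  show "\<forall>e\<in>ends_of {#v#}. e \<in> {h1, h2, h3} \<or> inw g e = inw g' e \<or> inw g (flip e) = inw g' (flip e)" for g g'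
    by (simp add: ends_of_add_mset view_set[OF v(1)])
  show "\<forall>e\<in>ends_of {#v', c#}. e \<in> {h1, h2, h3} \<or> inw g e = inw g' e \<or> inw g (flip e) = inw g' (flip e)"
    if "\<forall>n\<in>#{#v', c#}. sat g n" "\<forall>n\<in>#{#v', c#}. sat g' n" "\<forall>e\<in>{h1, h2, h3}. inw g e = inw g' e" for g g'
  proof -
    have "cross t (inw g (flip x)) (inw g h2) (inw g h3) (inw g (flip y))"
      "cross t (inw g' (flip x)) (inw g h2) (inw g h3) (inw g' (flip y))"
      using that by (simp_all add: S)
    then have "inw g (flip y) = inw g' (flip y) \<and> inw g (flip x) = inw g' (flip x)"
      unfolding cross_rotate_iff(1)[of t "inw g (flip x)"] cross_rotate_iff(1)[of t "inw g' (flip x)"]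
      by (rule cross_determ)
    then show ?thesis by (simp add: ends_of_add_mset view_set[OF v(2)] view_set[OF v(3)])
  qed
qed

lemma equivalent_R5:
  assumes v: "view v [h1, h2, h3]" "view m [k1, k3]" "view v' [x1, x2, x3]"
      "view c1 [h1, s, flip x1, k1]" "view c2 [h2, t, flip x2, flip s]" "view c3 [h3, k3, flip x3, flip t]"
    and o: "over c1 h1 \<longleftrightarrow> over c2 h2" "over c2 h2 \<longleftrightarrow> over c3 h3"
    and simple: "simple {#v', c1, c2, c3#}"
  shows "equivalent {h1, h2, h3, k1, k3} {#v, m#} {#v', c1, c2, c3#}"
proof (rule equivalentI)
  let ?l = "[x1, x2, x3] @ [h1, s, flip x1, k1] @ [h2, t, flip x2, flip s] @ [h3, k3, flip x3, flip t]"
  have d: "distinct ?l" by (rule simple_distinct(4)[OF simple v(3-6)])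
  then have dr: "distinct (rev ?l)" by (simp only: distinct_rev)
  have e: "distinct [h1, s, flip x1, k1]" "distinct [h2, t, flip x2, flip s]" "distinct [h3, k3, flip x3, flip t]"
    using d by simp_all
  define u where "u = over c3 h3"
  have o': "over c1 h1 = u" "over c2 h2 = u" "over c3 h3 = u" using o unfolding u_def by simp_all
  note S = sat_view_vertex[OF v(1)] sat_view_mark[OF v(2)] sat_view_vertex[OF v(3)]
    view_crossing(3)[OF v(4) e(1), unfolded o'] view_crossing(3)[OF v(5) e(2), unfolded o']
    view_crossing(3)[OF v(6) e(3), unfolded o']
  have slide: "cross u h b (opp x) k \<longleftrightarrow> x = act u h (opp b) \<and> k = act (\<not> u) (opp b) h"
    if "h \<in> X" "b \<in> X" "x \<in> X" for h b x k
    using that unfolding cross_def by (simp add: opp_inj)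
  show "\<exists>g'. (\<forall>e\<in>{h1, h2, h3, k1, k3}. g' (piece e) = g (piece e)) \<and> (\<forall>n\<in>#{#v', c1, c2, c3#}. sat g' n)"
    if "\<forall>n\<in>#{#v, m#}. sat g n" for g
  proof -
    have g: "g (piece h1) \<in> X" "g (piece h2) \<in> X" "g (piece h3) \<in> X" "g (piece k1) \<in> X" "g (piece k3) \<in> X"
      and X: "inw g h1 \<in> X" "inw g h2 \<in> X" "inw g h3 \<in> X" "inw g k1 \<in> X" "inw g k3 \<in> X"
      and c: "vert (inw g h3) (inw g h2) (inw g h1)" and k: "inw g k3 = opp (inw g k1)"
      using that vert_rotate_iff(1)[of "inw g h1"] by (simp_all add: S inw_in cong: conj_cong)
    \<comment> \<open>The strand is followed from \<open>k3\<close> past \<open>h3\<close>,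
      \<open>h2\<close>, \<open>h1\<close>, the order in which \<open>vert\<close> reads the vertex.
      Its successive colors are \<open>K\<close>, \<open>opp T\<close>, \<open>opp R\<close>; that
      the last crossing yields the color already given at \<open>k1\<close> is
      \<open>vert_act(1)\<close>.\<close>
    define K where "K = opp (inw g k3)"
    define T where "T = opp (act (\<not> u) K (inw g h3))"
    define R where "R = opp (act (\<not> u) (opp T) (inw g h2))"
    define Y1 where "Y1 = act u (inw g h1) (opp R)"
    define Y2 where "Y2 = act u (inw g h2) (opp T)"
    define Y3 where "Y3 = act u (inw g h3) K"
    have K: "K \<in> X" "K = inw g k1" using X k by (simp_all add: K_def)
    have T: "T \<in> X" "opp T = act (\<not> u) K (inw g h3)" using X K by (simp_all add: T_def)
    have R: "R \<in> X" "opp R = act (\<not> u) (opp T) (inw g h2)" using X T(1) by (simp_all add: R_def)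
    have Y: "Y1 \<in> X" "Y2 \<in> X" "Y3 \<in> X" using X K T(1) R(1) by (simp_all add: Y1_def Y2_def Y3_def)
    have "inw g k1 = act (\<not> u) (opp R) (inw g h1)"
      using vert_act(1)[OF c K(1), of u] unfolding R(2) T(2) K(2) by simp
    then have "cross u (inw g h1) R (opp Y1) (inw g k1)" "cross u (inw g h2) T (opp Y2) (opp R)"
      "cross u (inw g h3) (inw g k3) (opp Y3) (opp T)"
      using slide X Y T(1) R(1) by (simp_all add: Y1_def Y2_def Y3_def R(2) T(2) K_def)
    moreover have "vert Y1 Y3 Y2"
      using vert_act(2)[OF c K(1), of u] unfolding vert_rotate_iff(1)[of Y1]
      unfolding Y1_def Y2_def Y3_def R(2) T(2) .
    ultimately show ?thesis
      using g T(1) R(1) Y d dr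
      by (intro exI[of _ "put s R (put t T (put x1 Y1 (put x2 Y2 (put x3 Y3 g))))"]) (simp add: S put_simps)
  qed
  show "\<exists>g'. (\<forall>e\<in>{h1, h2, h3, k1, k3}. g' (piece e) = g (piece e)) \<and> (\<forall>n\<in>#{#v, m#}. sat g' n)"
    if "\<forall>n\<in>#{#v', c1, c2, c3#}. sat g n" for g
  proof -
    have g: "g (piece h1) \<in> X" "g (piece h2) \<in> X" "g (piece h3) \<in> X" "g (piece k1) \<in> X" "g (piece k3) \<in> X"
      and X: "inw g h1 \<in> X" "inw g h2 \<in> X" "inw g h3 \<in> X" "inw g k1 \<in> X" "inw g k3 \<in> X"
        "inw g s \<in> X" "inw g t \<in> X" "inw g x1 \<in> X" "inw g x2 \<in> X" "inw g x3 \<in> X"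
      and c: "vert (inw g x3) (inw g x2) (inw g x1)"
        "cross u (inw g h1) (inw g s) (opp (inw g x1)) (inw g k1)"
        "cross u (inw g h2) (inw g t) (opp (inw g x2)) (opp (inw g s))"
        "cross u (inw g h3) (inw g k3) (opp (inw g x3)) (opp (inw g t))"
      using that vert_rotate_iff(1)[of "inw g x1"] by (simp_all add: S inw_in inw_flip cong: conj_cong)
    define K where "K = opp (inw g k3)"
    have K: "K \<in> X" "inw g k3 = opp K" using X by (simp_all add: K_def)
    have 3: "inw g x3 = act u (inw g h3) K" "opp (inw g t) = act (\<not> u) K (inw g h3)"
      using c(4) slide[OF X(3,5,10)] by (simp_all add: K_def)
    have 2: "inw g x2 = act u (inw g h2) (opp (inw g t))" "opp (inw g s) = act (\<not> u) (opp (inw g t)) (inw g h2)"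
      using c(3) slide[OF X(2,7,9)] by blast+
    have 1: "inw g x1 = act u (inw g h1) (opp (inw g s))" "inw g k1 = act (\<not> u) (opp (inw g s)) (inw g h1)"
      using c(2) slide[OF X(1,6,8)] by blast+
    have v: "vert (inw g h3) (inw g h2) (inw g h1)"
      by (rule vert_act_back[OF c(1)[unfolded 1 2 3] X(3,2,1) K(1)])
    \<comment> \<open>Going around the vertex changes nothing only because the three edges multiply
      to 1, so the vertex condition has to be recovered first.\<close>
    have "inw g k1 = K"
      unfolding 1 2 3 by (rule vert_act(1)[OF v K(1)])
    then show ?thesis
      using g v K(2) vert_rotate_iff(1)[of "inw g h1"] by (intro exI[of _ g]) (simp add: S)
  qed
  show "\<forall>e\<in>ends_of {#v, m#}. e \<in> {h1, h2, h3, k1, k3} \<or> inw g e = inw g' e \<or> inw g (flip e) = inw g' (flip e)" for g g'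
    by (simp add: ends_of_add_mset view_set[OF v(1)] view_set[OF v(2)])
  show "\<forall>e\<in>ends_of {#v', c1, c2, c3#}. e \<in> {h1, h2, h3, k1, k3} \<or> inw g e = inw g' e \<or> inw g (flip e) = inw g' (flip e)"
    if "\<forall>n\<in>#{#v', c1, c2, c3#}. sat g n" "\<forall>n\<in>#{#v', c1, c2, c3#}. sat g' n"
      "\<forall>e\<in>{h1, h2, h3, k1, k3}. inw g e = inw g' e" for g g'
  proof -
    have X: "g (piece s) \<in> X" "g' (piece s) \<in> X" "g (piece t) \<in> X" "g' (piece t) \<in> X" using that by (simp_all add: S)
    have "cross u (inw g h3) (inw g k3) (inw g (flip x3)) (inw g (flip t))"
      "cross u (inw g h3) (inw g k3) (inw g' (flip x3)) (inw g' (flip t))"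
      using that by (simp_all add: S)
    then have 3: "inw g (flip x3) = inw g' (flip x3) \<and> inw g (flip t) = inw g' (flip t)" by (rule cross_determ)
    then have t: "inw g t = inw g' t" using X by (simp add: inw_flip opp_inj inw_in)
    have "cross u (inw g h2) (inw g t) (inw g (flip x2)) (inw g (flip s))"
      "cross u (inw g h2) (inw g t) (inw g' (flip x2)) (inw g' (flip s))"
      using that t by (simp_all add: S)
    then have 2: "inw g (flip x2) = inw g' (flip x2) \<and> inw g (flip s) = inw g' (flip s)" by (rule cross_determ)
    then have s: "inw g s = inw g' s" using X by (simp add: inw_flip opp_inj inw_in)
    have "cross u (inw g h1) (inw g s) (inw g (flip x1)) (inw g k1)"
      "cross u (inw g h1) (inw g s) (inw g' (flip x1)) (inw g k1)"
      using that s by (simp_all add: S)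
    then have "inw g (flip x1) = inw g' (flip x1) \<and> inw g k1 = inw g k1" by (rule cross_determ)
    with 2 3 s t show ?thesis
      by (simp add: ends_of_add_mset view_set[OF v(3)] view_set[OF v(4)] view_set[OF v(5)] view_set[OF v(6)])
  qed
qed

lemma equivalent_R6:
  assumes v: "view v [p, x, s]" "view w [flip x, q, r]" "view v' [p, q, y]" "view w' [flip y, r, s]"
    and simple: "simple {#v, w#}" "simple {#v', w'#}"
  shows "equivalent {p, q, r, s} {#v, w#} {#v', w'#}"
proof (rule equivalentI)
  have d: "distinct ([p, x, s] @ [flip x, q, r])" by (rule simple_distinct(2)[OF simple(1) v(1,2)])
  then have dr: "distinct (rev ([p, x, s] @ [flip x, q, r]))" by (simp only: distinct_rev)
  have d': "distinct ([p, q, y] @ [flip y, r, s])" by (rule simple_distinct(2)[OF simple(2) v(3,4)])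
  then have dr': "distinct (rev ([p, q, y] @ [flip y, r, s]))" by (simp only: distinct_rev)
  note S = sat_view_vertex[OF v(1)] sat_view_vertex[OF v(2)] sat_view_vertex[OF v(3)] sat_view_vertex[OF v(4)]
  show "\<exists>g'. (\<forall>e\<in>{p, q, r, s}. g' (piece e) = g (piece e)) \<and> (\<forall>n\<in>#{#v', w'#}. sat g' n)"
    if "\<forall>n\<in>#{#v, w#}. sat g n" for g
  proof -
    have g: "g (piece p) \<in> X" "g (piece q) \<in> X" "g (piece r) \<in> X" "g (piece s) \<in> X"
      and c: "vert (inw g p) (inw g s) (inw g x)" "vert (opp (inw g x)) (inw g r) (inw g q)"
      using that by (simp_all add: S inw_flip cong: conj_cong)
    obtain z where z: "z \<in> X" "vert (inw g p) z (inw g q)" "vert (opp z) (inw g s) (inw g r)"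
      using vert_assoc[OF c] by (elim bexE conjE)
    show ?thesis
      using g z d' dr' by (intro exI[of _ "put y z g"]) (simp add: S put_simps)
  qed
  text \<open>An IH-move is undone by the IH-move that is rotated by a right angle.\<close>
  show "\<exists>g'. (\<forall>e\<in>{p, q, r, s}. g' (piece e) = g (piece e)) \<and> (\<forall>n\<in>#{#v, w#}. sat g' n)"
    if "\<forall>n\<in>#{#v', w'#}. sat g n" for g
  proof -
    have g: "g (piece p) \<in> X" "g (piece q) \<in> X" "g (piece r) \<in> X" "g (piece s) \<in> X"
      and c: "vert (inw g q) (inw g p) (inw g y)" "vert (opp (inw g y)) (inw g s) (inw g r)"
      using that vert_rotate_iff(2)[of "inw g p" "inw g y"] by (simp_all add: S inw_flip cong: conj_cong)
    obtain z where z: "z \<in> X" "vert (inw g q) z (inw g r)" "vert (opp z) (inw g p) (inw g s)"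
      using vert_assoc[OF c] by (elim bexE conjE)
    have "vert (inw g p) (inw g s) (opp z)" "vert z (inw g r) (inw g q)"
      using z(2,3) vert_rotate by blast+
    then show ?thesis
      using g z(1) d dr by (intro exI[of _ "put x (opp z) g"]) (simp add: S put_simps)
  qed
  show "\<forall>e\<in>ends_of {#v, w#}. e \<in> {p, q, r, s} \<or> inw g e = inw g' e \<or> inw g (flip e) = inw g' (flip e)"
    if "\<forall>n\<in>#{#v, w#}. sat g n" "\<forall>n\<in>#{#v, w#}. sat g' n" "\<forall>e\<in>{p, q, r, s}. inw g e = inw g' e" for g g'
  proof -
    have "vert (inw g p) (inw g s) (inw g x)" "vert (inw g p) (inw g s) (inw g' x)"
      using that by (simp_all add: S)
    then have "inw g x = inw g' x" by (rule vert_determ)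
    then show ?thesis by (simp add: ends_of_add_mset view_set[OF v(1)] view_set[OF v(2)])
  qed
  show "\<forall>e\<in>ends_of {#v', w'#}. e \<in> {p, q, r, s} \<or> inw g e = inw g' e \<or> inw g (flip e) = inw g' (flip e)"
    if "\<forall>n\<in>#{#v', w'#}. sat g n" "\<forall>n\<in>#{#v', w'#}. sat g' n" "\<forall>e\<in>{p, q, r, s}. inw g e = inw g' e" for g g'
  proof -
    have "vert (inw g q) (inw g p) (inw g y)" "vert (inw g q) (inw g p) (inw g' y)"
      using that vert_rotate_iff(2)[of "inw g p"] vert_rotate_iff(2)[of "inw g' p"] by (simp_all add: S)
    then have "inw g y = inw g' y" by (rule vert_determ)
    then show ?thesis by (simp add: ends_of_add_mset view_set[OF v(3)] view_set[OF v(4)])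
  qed
qed

lemma local_move_equivalent:
  assumes "local_move B P P'" "simple P" "simple P'"
  shows "equivalent B P P'"
  using assms
proof cases
  case (R1 m h k c l)
  then show ?thesis using equivalent_R1 assms(3) by simp
next
  case (R2 m h1 h2 n k1 k2 c y x d)
  then show ?thesis using equivalent_R2 assms(3) by simp
next
  case (R3 ha hb hc ab a1 b1 x y ac c1 a2 z bc b2 c2 ac' z' x' ab' y' bc')
  show ?thesis
    unfolding R3(1-3) by (rule equivalent_R3[OF R3(4-18) assms(2,3)[unfolded R3(2,3)]])
next
  case (R4 v h1 h2 h3 v' x y c)
  then show ?thesis using equivalent_R4 assms(3) by simp
next
  case (R5 v h1 h2 h3 m k1 k3 v' x1 x2 x3 c1 s c2 t c3)
  show ?thesis
    unfolding R5(1-3) by (rule equivalent_R5[OF R5(4-11) assms(3)[unfolded R5(3)]])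
next
  case (R6 v p x s w q r v' y w')
  then show ?thesis using equivalent_R6 assms(2,3) by simp
qed

lemma local_move_ends:
  assumes "local_move B P P'"
  shows "B \<subseteq> ends_of P \<and> B \<subseteq> ends_of P' \<and> (\<forall>h\<in>ends_of P. h \<in> B \<or> flip h \<in> ends_of P) \<and>
    (\<forall>h\<in>ends_of P'. h \<in> B \<or> flip h \<in> ends_of P')"
  using assms
  by cases (simp_all add: ends_of_add_mset view_set)

section \<open>Gluing the inside of the disk to the outside\<close>

lemma sat_cong:
  assumes "\<And>h. h \<in> set (ends n) \<Longrightarrow> c (piece h) = c' (piece h)"
  shows "sat c n \<longleftrightarrow> sat c' n"
proof -
  have "\<forall>h\<in>set (ends n). c (piece h) = c' (piece h)" using assms by blast
  then show ?thesis by (cases n) (simp_all add: sat_def)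
qed

lemma simple_union:
  assumes "simple (N + P)" shows "simple P"
  unfolding simple_def
proof
  fix h
  have "count (\<Sum>n\<in>#N. mset (ends n)) h + count (\<Sum>n\<in>#P. mset (ends n)) h \<le> 1"
    using assms unfolding simple_def by simp
  then show "count (\<Sum>n\<in>#P. mset (ends n)) h \<le> 1" by (rule add_leD2)
qed

lemma simple_disjoint:
  assumes "simple (N + P)"
  shows "ends_of N \<inter> ends_of P = {}"
proof -
  have *: "0 < count (\<Sum>n\<in>#D. mset (ends n)) h" if "h \<in> ends_of D" for h and D :: "'e node multiset"
    using that by (induction D) (auto simp: ends_of_add_mset)
  show ?thesis
  proof (rule ccontr)
    assume "ends_of N \<inter> ends_of P \<noteq> {}"
    then obtain h where "h \<in> ends_of N" "h \<in> ends_of P" by blast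
    then have "0 < count (\<Sum>n\<in>#N. mset (ends n)) h" "0 < count (\<Sum>n\<in>#P. mset (ends n)) h"
      using * by blast+
    moreover have "count (\<Sum>n\<in>#N. mset (ends n)) h + count (\<Sum>n\<in>#P. mset (ends n)) h \<le> 1"
      using assms unfolding simple_def by simp
    ultimately show False by linarith
  qed
qed

text \<open>Outside the disk the given colors are kept, inside they are those supplied by
  \<open>extends\<close>. They fit together because a piece seen from both sides crosses the
  boundary, where the two agree; \<open>rigid\<close> gives the uniqueness half.\<close>

lemma transfer_coloring:
  assumes D': "simple (N + P')" and B: "B \<subseteq> ends_of P'" "\<forall>h\<in>ends_of P'. h \<in> B \<or> flip h \<in> ends_of P'"
    and ext: "extends B P P'" and rigid: "rigid B P'" and c: "\<forall>n\<in>#N + P. sat c n"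
  shows "\<exists>c'. (\<forall>n\<in>#N + P'. sat c' n) \<and> (\<forall>e\<in>pieces N \<union> piece ` B. c' e = c e)"
    and "\<lbrakk>\<forall>n\<in>#N + P'. sat f n; \<forall>n\<in>#N + P'. sat f' n; \<forall>e\<in>pieces N \<union> piece ` B. f e = f' e\<rbrakk> \<Longrightarrow>
      \<forall>e\<in>pieces (N + P'). f e = f' e"
proof -
  have N: "e \<in> piece ` B" if e: "e \<in> pieces N" "e \<in> pieces P'" for e
  proof -
    obtain h k where h: "e = piece h" "h \<in> ends_of P'" and k: "e = piece k" "k \<in> ends_of N"
      using e unfolding pieces_def by blast
    have "k = h \<or> k = flip h" using h(1) k(1) piece_eq_iff[of k h] by simp
    \<comment> \<open>An end belongs to only one node, so the end \<open>k\<close> outside cannot be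
      an end in \<open>P'\<close>. Hence \<open>k = flip h\<close> is missing from
      \<open>P'\<close>, which happens only for boundary pieces.\<close>
    then have "h \<in> B" using simple_disjoint[OF D'] B(2) h(2) k(2) by blast
    with h(1) show ?thesis by blast
  qed
  have "\<forall>n\<in>#P. sat c n" using c by simp
  then obtain d where d: "\<forall>h\<in>B. d (piece h) = c (piece h)" "\<forall>n\<in>#P'. sat d n"
    using ext unfolding extends_def by blast
  define c' where "c' e = (if e \<in> pieces P' then d e else c e)" for e
  have E: "c' e = c e" if "e \<in> pieces N \<union> piece ` B" for e
    using that N[of e] d(1) unfolding c'_def by auto
  have "sat c' n" if "n \<in># N" for n
  proof -
    have "c' (piece h) = c (piece h)" if "h \<in> set (ends n)" for h
      using that \<open>n \<in># N\<close> by (intro E) (auto simp: pieces_def ends_of_def)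
    then show ?thesis using sat_cong[of n c' c] c \<open>n \<in># N\<close> by simp
  qed
  moreover have "sat c' n" if "n \<in># P'" for n
  proof -
    have "c' (piece h) = d (piece h)" if "h \<in> set (ends n)" for h
      using that \<open>n \<in># P'\<close> unfolding c'_def by (auto simp: pieces_def ends_of_def)
    then show ?thesis using sat_cong[of n c' d] d(2) \<open>n \<in># P'\<close> by simp
  qed
  ultimately have "\<forall>n\<in>#N + P'. sat c' n" by auto
  with E show "\<exists>c'. (\<forall>n\<in>#N + P'. sat c' n) \<and> (\<forall>e\<in>pieces N \<union> piece ` B. c' e = c e)" by blast
  show "\<forall>e\<in>pieces (N + P'). f e = f' e"
    if f: "\<forall>n\<in>#N + P'. sat f n" "\<forall>n\<in>#N + P'. sat f' n" "\<forall>e\<in>pieces N \<union> piece ` B. f e = f' e"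
  proof -
    have "\<forall>e\<in>pieces P'. f e = f' e" using rigid f unfolding rigid_def by simp
    moreover have "pieces (N + P') = pieces N \<union> pieces P'" by (auto simp: pieces_def ends_of_def)
    ultimately show ?thesis using f(3) by blast
  qed
qed

section \<open>Colorings of semi-arcs\<close>

lemma semiarc_eq:
  assumes "Mark i j \<in># D"
  shows "semiarc D i = semiarc D j"
proof -
  have "(i, j) \<in> same_semiarc D" "(j, i) \<in> same_semiarc D"
    using assms unfolding same_semiarc_def by blast+
  then show ?thesis unfolding semiarc_def same_semiarc_def by (auto intro: rtrancl_trans)
qed

lemma coloring_sat:
  assumes "coloring D C" "n \<in># D"
  shows "sat (\<lambda>e. C (semiarc D e)) n"
proof -
  have "C (semiarc D (piece h)) \<in> X" if "h \<in> set (ends n)" for h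
  proof -
    have "semiarc D (piece h) \<in> semiarcs D"
      using that assms(2) unfolding semiarcs_def pieces_def ends_of_def by blast
    then show ?thesis using assms(1) unfolding coloring_def by blast
  qed
  then show ?thesis
    using assms semiarc_eq[of _ _ D] unfolding sat_def coloring_def by auto
qed

lemma sat_coloring:
  assumes "\<forall>n\<in>#D. sat c n"
  shows "\<exists>C. coloring D C \<and> (\<forall>e\<in>pieces D. C (semiarc D e) = c e)"
proof -
  have const: "c i = c j" if "(i, j) \<in> same_semiarc D" for i j
    using that unfolding same_semiarc_def
  proof induction
    case (step j k)
    then have "c j = c k" using assms unfolding sat_def by fastforce
    with step.IH show ?case by simp
  qed simp
  \<comment> \<open>By \<open>const\<close> any representative of a semi-arc gives the same color.
    The restriction to \<open>semiarcs D\<close> fixes the values elsewhere, so that uniqueness can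
    mean equality of functions.\<close>
  define C where "C = (\<lambda>S\<in>semiarcs D. c (SOME e. e \<in> S))"
  have C: "C (semiarc D e) = c e" if "e \<in> pieces D" for e
  proof -
    have "e \<in> semiarc D e" unfolding semiarc_def same_semiarc_def by blast
    then have "(SOME i. i \<in> semiarc D e) \<in> semiarc D e" by (rule someI)
    then have "c (SOME i. i \<in> semiarc D e) = c e"
      using const unfolding semiarc_def by (metis Image_singleton_iff)
    then show ?thesis using that by (simp add: C_def semiarcs_def)
  qed
  have X: "c e \<in> X" if "e \<in> pieces D" for e
    using that assms unfolding pieces_def ends_of_def sat_def by blast
  have "node_condition (\<lambda>e. C (semiarc D e)) n" if n: "n \<in># D" for n
  proof -
    have "C (semiarc D (piece h)) = c (piece h)" if "h \<in> set (ends n)" for h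
      using that n by (intro C) (auto simp: pieces_def ends_of_def)
    then have "sat (\<lambda>e. C (semiarc D e)) n"
      using sat_cong[of n "\<lambda>e. C (semiarc D e)" c] assms n by simp
    then show ?thesis unfolding sat_def by blast
  qed
  moreover have "C \<in> semiarcs D \<rightarrow>\<^sub>E X"
  proof (rule PiE_I)
    fix S assume "S \<in> semiarcs D"
    then show "C S \<in> X" using C X unfolding semiarcs_def by auto
  qed (simp add: C_def)
  ultimately show ?thesis using C unfolding coloring_def by blast
qed

lemma coloring_eqI:
  assumes "coloring D C" "coloring D C'" "\<forall>e\<in>pieces D. C (semiarc D e) = C' (semiarc D e)"
  shows "C = C'"
proof (rule PiE_ext)
  show "C \<in> semiarcs D \<rightarrow>\<^sub>E X" "C' \<in> semiarcs D \<rightarrow>\<^sub>E X" using assms unfolding coloring_def by blast+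
  show "C S = C' S" if "S \<in> semiarcs D" for S using that assms(3) unfolding semiarcs_def by blast
qed

lemma move_coloring:
  assumes "diagram D" "diagram D'" "move D D' E" "coloring D C"
  shows "\<exists>!C'. coloring D' C' \<and> (\<forall>e\<in>E. C' (semiarc D' e) = C (semiarc D e))"
proof -
  obtain N B P P' where m: "local_move B P P' \<or> local_move B P' P"
    and D: "D = N + P" "D' = N + P'" and E: "E = pieces N \<union> piece ` B"
    using assms(3) unfolding move_def by blast
  have s: "simple (N + P)" "simple (N + P')"
    using assms(1,2) D unfolding diagram_def simple_def by blast+
  have "equivalent B P P' \<or> equivalent B P' P"
    using m local_move_equivalent simple_union[OF s(1)] simple_union[OF s(2)] by blast
  then have ext: "extends B P P'" and rig: "rigid B P'" unfolding equivalent_def by blast+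
  have B: "B \<subseteq> ends_of P'" "\<forall>h\<in>ends_of P'. h \<in> B \<or> flip h \<in> ends_of P'"
    using m local_move_ends[of B P P'] local_move_ends[of B P' P] by blast+
  have E': "E \<subseteq> pieces D'" unfolding E D pieces_def using B(1) by (auto simp: ends_of_def)
  have c: "\<forall>n\<in>#N + P. sat (\<lambda>e. C (semiarc D e)) n" using coloring_sat[OF assms(4)] D(1) by simp
  note transfer = transfer_coloring[OF s(2) B ext rig c, folded E]
  obtain c' where c': "\<forall>n\<in>#N + P'. sat c' n" "\<forall>e\<in>E. c' e = C (semiarc D e)"
    using transfer(1) by (elim exE conjE)
  obtain C' where C': "coloring D' C'" "\<forall>e\<in>pieces D'. C' (semiarc D' e) = c' e"
    using sat_coloring[OF c'(1)[folded D(2)]] by (elim exE conjE)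
  show ?thesis
  proof (rule ex1I[of _ C'], rule conjI)
    show "coloring D' C'" by (rule C'(1))
    show "\<forall>e\<in>E. C' (semiarc D' e) = C (semiarc D e)" using C'(2) c'(2) E' by (simp add: subset_iff)
  next
    fix C'' assume C'': "coloring D' C'' \<and> (\<forall>e\<in>E. C'' (semiarc D' e) = C (semiarc D e))"
    have "\<forall>e\<in>E. C'' (semiarc D' e) = C' (semiarc D' e)"
      using C'' C'(2) c'(2) E' by (simp add: subset_iff)
    then have "\<forall>e\<in>pieces (N + P'). C'' (semiarc D' e) = C' (semiarc D' e)"
      using coloring_sat[of D' C''] coloring_sat[of D' C'] C'' C'(1) unfolding D(2)
      by (intro transfer(2)) blast+
    then show "C'' = C'" using C'' C'(1) coloring_eqI[of D' C'' C'] D(2) by simp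
  qed
qed

end

theorem theorem5p3:
  fixes X :: "'x set"
    and us os :: "'x \<Rightarrow> 'x \<Rightarrow> 'x"
    and L :: "'l set"
    and G :: "'l \<Rightarrow> ('x, 'm) monoid_scheme"
    and D D' :: "'e node multiset"
    and E :: "'e set"
    and C :: "'e set \<Rightarrow> 'x"
  assumes "multiple_conjugation_biquandle X us os L G"
    and "diagram D"
    and "diagram D'"
    and "move D D' E"
    and "multiple_conjugation_biquandle.coloring X us os L G D C"
  shows "\<exists>!C'. multiple_conjugation_biquandle.coloring X us os L G D' C' \<and>
           (\<forall>e\<in>E. C' (semiarc D' e) = C (semiarc D e))"
  using multiple_conjugation_biquandle.move_coloring[OF assms] .

end
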